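(* Let $f:\mathbb{R}^n\to\mathbb{R}$ satisfy (A0)-(A2), and let $\mathcal{A}^\star:=\{x^\star\in\mathbb{R}^n: f(x^\star)\le f(x)\ \forall x\in\mathbb{R}^n\}$ be its set of global minima. Then, for any initial condition $x_\circ\in\mathbb{R}^n$, the sequence of iterates $x_{kji}$ generated by Algorithm 1 (the modified RSP algorithm together with its line minimization procedure) satisfies $$\lim_{k\to\infty}\|x_{kji}\|_{\mathcal{A}^\star}=0\qquad\text{for all } j=0,1,\dots,n-1 \text{ and all } i\in[0,i_{kj}^\star],$$ where $i^\star_{kj}$ is the number of steps computed in the line minimization at iteration $k$ along direction $d_j$.
   Context: For a set $S\subset\mathbb{R}^n$, $\|x\|_S:=\inf_{y\in S}\|x-y\|$. The limit means that $\max_{0\le j\le n-1}\max_{0\le i\le i_{kj}^\star}\|x_{kji}\|_{\mathcal{A}^\star}\to0$ as $k\to\infty$. Assumptions. (A0) $f$ is continuously differentiable and lower bounded (only its sampled values are available). (A1) Every local minimum of $f$ is a global minimum; every local maximum is an isolated point and $f$ is analytic at every local maximum; there are no saddle points (every critical point is a local minimum or a local maximum). (A2) The sublevel sets $\mathcal{L}_f(c)=\{x: f(x)\le c\}$ are compact for all $c\in\mathbb{R}$. The function $\rho:\mathbb{R}_{\ge0}\to\mathbb{R}_{\ge0}$ is $\rho(\Delta)=\Delta^{1/\Delta}$ for $\Delta\le e$ (with $\rho(0)=0$) and $\rho(\Delta)=\Delta+(e^{1/e}-e)$ for $\Delta>e$. Algorithm 1. Parameters: $\delta_{det}>0$, $0<\lambda_s<1<\lambda_t$,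 $\mu\in(0,1/\lambda_t)$, $\theta\in(0,1)$, $\gamma\ge1$. Data: a current point (initially $x_\circ$), linearly independent directions $d_0,\dots,d_{n-1}\in\mathbb{R}^n$, a global step size $\Phi>0$, and step sizes $\Delta_0,\dots,\Delta_{n-1}$ with $\lambda_s\Phi\le\Delta_j\le\lambda_t\Phi$. Line minimization along $d_j$ from a point $x$: set $y=x$. If $f(y+\Delta_jd_j)\le f(y)-\rho(\Delta_j)$, then, as long as this inequality holds, replace $y$ by $y+\Delta_jd_j$ and then $\Delta_j$ by $\min\{\gamma\Delta_j,\lambda_t\Phi\}$. If the very first test fails, do the same with $-d_j$ in place of $d_j$. Stop at the first failure (of the negative search, if the positive one failed at once). The output is the last accepted point $y=x+\alpha_jd_j$, with signed distance $\alpha_j\in\mathbb{R}$; $\alpha_j=0$ means that no improvement was found. If $\alpha_j=0$, then $\Delta_j$ is replaced by $\max\{\theta\Delta_j,\lambda_s\Phi\}$. Iteration (cycle) $k$: first perform a line minimization along $d_{n-1}$ from the current point, giving $x_{k0}$. Then, for $j=0,1,\dots,n-1$, perform a line minimization along $d_j$ from $x_{kj}$, giving $x_{k,j+1}=x_{kj}+\alpha_jd_j$; $x_{kji}$ ($0\le i\le i_{kj}^\star$) denotes the successive accepted points of this line minimization, $x_{kj0}=x_{kj}$, and $i_{kj}^\star$ is its number of accepted steps. If $\alpha_j=0$ for all $j=0,\dots,n-1$, replace $\Phi$ by $\mu\Phi$ and then every $\Delta_j$ by $\min\{\Delta_j,\lambda_t\Phi\}$ (with the new $\Phi$). Finally let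 $d_{new}=\sum_{j=0}^{n-1}\alpha_jd_j$. If $\det[d_1\ \cdots\ d_{n-1}\ d_{new}]>\delta_{det}$, the directions are replaced by $(d_1,\dots,d_{n-1},d_{new})$; otherwise the same set is retained, in the order $(d_1,\dots,d_{n-1},d_0)$. The step sizes are shifted accordingly, and the last direction receives as step size the maximum of the step sizes of the other directions. The next cycle starts from $x_{kn}$. *)

theory Defs
  imports "HOL-Analysis.Analysis"
begin

section \<open>The class of objective functions\<close>

definition continuously_differentiable :: "('a::real_inner \<Rightarrow> real) \<Rightarrow> bool" where
  "continuously_differentiable f \<longleftrightarrow> (\<exists>g. (\<forall>x. GDERIV f x :> g x) \<and> continuous_on UNIV g)"

definition local_minimum :: "('a::metric_space \<Rightarrow> real) \<Rightarrow> 'a \<Rightarrow> bool" where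
  "local_minimum f x \<longleftrightarrow> (\<exists>e>0. \<forall>y\<in>ball x e. f x \<le> f y)"

definition local_maximum :: "('a::metric_space \<Rightarrow> real) \<Rightarrow> 'a \<Rightarrow> bool" where
  "local_maximum f x \<longleftrightarrow> (\<exists>e>0. \<forall>y\<in>ball x e. f y \<le> f x)"

definition critical_point :: "('a::real_inner \<Rightarrow> real) \<Rightarrow> 'a \<Rightarrow> bool" where
  "critical_point f x \<longleftrightarrow> GDERIV f x :> 0"

definition global_minima :: "('a \<Rightarrow> real) \<Rightarrow> 'a set" where
  "global_minima f = {x. \<forall>y. f x \<le> f y}"

text \<open>Real analyticity at a point: near \<open>x\<close>, the function is the sum of a power series in
  several variables. The index \<open>m\<close> ranges over all multi-indices.\<close>

definition real_analytic_at :: "(real ^ 'n::finite \<Rightarrow> real) \<Rightarrow> real ^ 'n \<Rightarrow> bool" where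
  "real_analytic_at f x \<longleftrightarrow>
     (\<exists>(c :: ('n \<Rightarrow> nat) \<Rightarrow> real) r. r > 0 \<and>
        (\<forall>y\<in>ball x r. ((\<lambda>m. c m * (\<Prod>i\<in>UNIV. (y $ i - x $ i) ^ m i)) has_sum f y) UNIV))"

definition assumption_A0 :: "(real ^ 'n::finite \<Rightarrow> real) \<Rightarrow> bool" where
  "assumption_A0 f \<longleftrightarrow> continuously_differentiable f \<and> bdd_below (range f)"

text \<open>A local maximum is required to be isolated in the set of all local maxima.\<close>

definition assumption_A1 :: "(real ^ 'n::finite \<Rightarrow> real) \<Rightarrow> bool" where
  "assumption_A1 f \<longleftrightarrow>
     (\<forall>x. local_minimum f x \<longrightarrow> x \<in> global_minima f) \<and>
     (\<forall>x. local_maximum f x \<longrightarrow> x isolated_in {z. local_maximum f z} \<and> real_analytic_at f x) \<and>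
     (\<forall>x. critical_point f x \<longrightarrow> local_minimum f x \<or> local_maximum f x)"

definition assumption_A2 :: "(real ^ 'n::finite \<Rightarrow> real) \<Rightarrow> bool" where
  "assumption_A2 f \<longleftrightarrow> (\<forall>c. compact {x. f x \<le> c})"


section \<open>Line minimization\<close>

text \<open>Only the values at \<open>\<Delta> \<ge> 0\<close> matter.\<close>

definition rho :: "real \<Rightarrow> real" where
  "rho \<Delta> = (if \<Delta> = 0 then 0
            else if \<Delta> \<le> exp 1 then \<Delta> powr (1 / \<Delta>)
            else \<Delta> + (exp (1 / exp 1) - exp 1))"

record rsp_params =
  delta_det :: real
  lam_s :: real
  lam_t :: real
  mu_par :: real
  theta_par :: real
  gamma_par :: real

definition valid_params :: "rsp_params \<Rightarrow> bool" where
  "valid_params P \<longleftrightarrow>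
     delta_det P > 0 \<and>
     0 < lam_s P \<and> lam_s P < 1 \<and> 1 < lam_t P \<and>
     0 < mu_par P \<and> mu_par P < 1 / lam_t P \<and>
     0 < theta_par P \<and> theta_par P < 1 \<and>
     gamma_par P \<ge> 1"

text \<open>
  A search along the vector \<open>v\<close> from the point \<open>x\<close> with initial step size \<open>\<Delta>\<close>, where \<open>g\<close> is the
  growth factor and \<open>M\<close> the upper bound of the step size. \<open>search_state g M v x \<Delta> i\<close> is the point
  together with the step size after \<open>i\<close> steps, on the premise that all of them are accepted, and
  \<open>search_steps\<close> is the number of steps that are accepted before the first failure. There is a
  first failure if \<open>f\<close> is bounded below and \<open>g \<ge> 1\<close>, \<open>M > 0\<close>, \<open>\<Delta> > 0\<close>, see \<open>search_terminates\<close>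
  below.\<close>

definition accepts ::
  "('v::real_vector \<Rightarrow> real) \<Rightarrow> 'v \<Rightarrow> 'v \<times> real \<Rightarrow> bool" where
  "accepts f v = (\<lambda>(y, \<Delta>). f (y + \<Delta> *\<^sub>R v) \<le> f y - rho \<Delta>)"

primrec search_state ::
  "real \<Rightarrow> real \<Rightarrow> 'v::real_vector \<Rightarrow> 'v \<Rightarrow> real \<Rightarrow> nat \<Rightarrow> 'v \<times> real" where
  "search_state g M v x \<Delta> 0 = (x, \<Delta>)"
| "search_state g M v x \<Delta> (Suc i) =
     (case search_state g M v x \<Delta> i of (y, D) \<Rightarrow> (y + D *\<^sub>R v, min (g * D) M))"

definition search_steps ::
  "('v::real_vector \<Rightarrow> real) \<Rightarrow> real \<Rightarrow> real \<Rightarrow> 'v \<Rightarrow> 'v \<Rightarrow> real \<Rightarrow> nat" where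
  "search_steps f g M v x \<Delta> = (LEAST i. \<not> accepts f v (search_state g M v x \<Delta> i))"

text \<open>
  The state of the algorithm: current point, directions \<open>d\<^sub>0, \<dots>, d\<^sub>n\<^sub>-\<^sub>1\<close>, global step size \<open>\<Phi>\<close>, and
  step sizes \<open>\<Delta>\<^sub>0, \<dots>, \<Delta>\<^sub>n\<^sub>-\<^sub>1\<close>. Values at indices \<open>\<ge> n\<close> are irrelevant.\<close>

record 'v rsp_state =
  pt :: 'v
  dirs :: "nat \<Rightarrow> 'v"
  gstep :: real
  steps :: "nat \<Rightarrow> real"

text \<open>The following functions describe the line minimization along \<open>d\<^sub>j\<close> in the state \<open>s\<close>. The
  search is made in the direction \<open>lm_sign P f j s * d\<^sub>j\<close>.\<close>

definition lm_sign ::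
  "rsp_params \<Rightarrow> ('v::real_vector \<Rightarrow> real) \<Rightarrow> nat \<Rightarrow> 'v rsp_state \<Rightarrow> real" where
  "lm_sign P f j s = (if accepts f (dirs s j) (pt s, steps s j) then 1 else - 1)"

definition lm_state ::
  "rsp_params \<Rightarrow> ('v::real_vector \<Rightarrow> real) \<Rightarrow> nat \<Rightarrow> 'v rsp_state \<Rightarrow> nat \<Rightarrow> 'v \<times> real" where
  "lm_state P f j s =
     search_state (gamma_par P) (lam_t P * gstep s) (lm_sign P f j s *\<^sub>R dirs s j) (pt s) (steps s j)"

definition lm_count ::
  "rsp_params \<Rightarrow> ('v::real_vector \<Rightarrow> real) \<Rightarrow> nat \<Rightarrow> 'v rsp_state \<Rightarrow> nat" where
  "lm_count P f j s =
     search_steps f (gamma_par P) (lam_t P * gstep s) (lm_sign P f j s *\<^sub>R dirs s j) (pt s) (steps s j)"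

definition lm_alpha ::
  "rsp_params \<Rightarrow> ('v::real_vector \<Rightarrow> real) \<Rightarrow> nat \<Rightarrow> 'v rsp_state \<Rightarrow> real" where
  "lm_alpha P f j s = lm_sign P f j s * (\<Sum>i<lm_count P f j s. snd (lm_state P f j s i))"

definition line_min ::
  "rsp_params \<Rightarrow> ('v::real_vector \<Rightarrow> real) \<Rightarrow> nat \<Rightarrow> 'v rsp_state \<Rightarrow> 'v rsp_state" where
  "line_min P f j s =
     s\<lparr>pt := pt s + lm_alpha P f j s *\<^sub>R dirs s j,
       steps := (steps s)(j :=
         (if lm_alpha P f j s = 0 then max (theta_par P * steps s j) (lam_s P * gstep s)
          else snd (lm_state P f j s (lm_count P f j s))))\<rparr>"


section \<open>The modified RSP algorithm\<close>

text \<open>The determinant of the matrix with columns \<open>c 0, \<dots>, c (n - 1)\<close>. The coordinates of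
  \<open>real ^ 'n\<close> are ordered by the linear order of \<open>'n\<close>, so the column with index \<open>j :: 'n\<close> has
  number \<open>card {k. k < j}\<close>.\<close>

definition det_columns :: "(nat \<Rightarrow> real ^ 'n::{finite,linorder}) \<Rightarrow> real" where
  "det_columns c = det (\<chi> i j. c (card {k. k < j}) $ i)"

text \<open>\<open>stage P f s j\<close> is the state in which the line minimization along \<open>d\<^sub>j\<close> is started, in a cycle
  that begins in state \<open>s\<close>; the preliminary line minimization is along \<open>d\<^sub>n\<^sub>-\<^sub>1\<close>.\<close>

primrec stage ::
  "rsp_params \<Rightarrow> (real ^ 'n::finite \<Rightarrow> real) \<Rightarrow> (real ^ 'n) rsp_state \<Rightarrow> nat \<Rightarrow> (real ^ 'n) rsp_state"
where
  "stage P f s 0 = line_min P f (CARD('n) - 1) s"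
| "stage P f s (Suc j) = line_min P f j (stage P f s j)"

definition cycle_alpha ::
  "rsp_params \<Rightarrow> (real ^ 'n::finite \<Rightarrow> real) \<Rightarrow> (real ^ 'n) rsp_state \<Rightarrow> nat \<Rightarrow> real" where
  "cycle_alpha P f s j = lm_alpha P f j (stage P f s j)"

definition new_dir ::
  "rsp_params \<Rightarrow> (real ^ 'n::finite \<Rightarrow> real) \<Rightarrow> (real ^ 'n) rsp_state \<Rightarrow> real ^ 'n" where
  "new_dir P f s = (\<Sum>j<CARD('n). cycle_alpha P f s j *\<^sub>R dirs s j)"

definition next_gstep ::
  "rsp_params \<Rightarrow> (real ^ 'n::finite \<Rightarrow> real) \<Rightarrow> (real ^ 'n) rsp_state \<Rightarrow> real" where
  "next_gstep P f s =
     (if \<forall>j<CARD('n). cycle_alpha P f s j = 0 then mu_par P * gstep s else gstep s)"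

text \<open>The step sizes at the end of a cycle, before they are shifted.\<close>

definition end_steps ::
  "rsp_params \<Rightarrow> (real ^ 'n::finite \<Rightarrow> real) \<Rightarrow> (real ^ 'n) rsp_state \<Rightarrow> nat \<Rightarrow> real" where
  "end_steps P f s j =
     (if \<forall>j<CARD('n). cycle_alpha P f s j = 0
      then min (steps (stage P f s CARD('n)) j) (lam_t P * next_gstep P f s)
      else steps (stage P f s CARD('n)) j)"

definition shift_last :: "nat \<Rightarrow> (nat \<Rightarrow> 'a) \<Rightarrow> 'a \<Rightarrow> nat \<Rightarrow> 'a" where
  "shift_last n a b j = (if j < n - 1 then a (Suc j) else b)"

definition next_dirs ::
  "rsp_params \<Rightarrow> (real ^ 'n::{finite,linorder} \<Rightarrow> real) \<Rightarrow> (real ^ 'n::_) rsp_state \<Rightarrow> nat \<Rightarrow> real ^ 'n::_"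
where
  "next_dirs P f s =
     (if det_columns (shift_last CARD('n) (dirs s) (new_dir P f s)) > delta_det P
      then shift_last CARD('n) (dirs s) (new_dir P f s)
      else shift_last CARD('n) (dirs s) (dirs s 0))"

text \<open>For \<open>n = 1\<close> there are no other directions, and the only direction keeps its step size.\<close>

definition next_steps ::
  "rsp_params \<Rightarrow> (real ^ 'n::finite \<Rightarrow> real) \<Rightarrow> (real ^ 'n) rsp_state \<Rightarrow> nat \<Rightarrow> real" where
  "next_steps P f s =
     shift_last CARD('n) (end_steps P f s)
       (if CARD('n) = 1 then end_steps P f s 0 else Max (end_steps P f s ` {1..<CARD('n)}))"

definition rsp_cycle ::
  "rsp_params \<Rightarrow> (real ^ 'n::{finite,linorder} \<Rightarrow> real) \<Rightarrow> (real ^ 'n::_) rsp_state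
     \<Rightarrow> (real ^ 'n::_) rsp_state" where
  "rsp_cycle P f s =
     \<lparr>pt = pt (stage P f s CARD('n)), dirs = next_dirs P f s,
      gstep = next_gstep P f s, steps = next_steps P f s\<rparr>"

primrec run_state ::
  "rsp_params \<Rightarrow> (real ^ 'n::{finite,linorder} \<Rightarrow> real) \<Rightarrow> (real ^ 'n::_) rsp_state \<Rightarrow> nat
     \<Rightarrow> (real ^ 'n::_) rsp_state" where
  "run_state P f s0 0 = s0"
| "run_state P f s0 (Suc k) = rsp_cycle P f (run_state P f s0 k)"

definition valid_init :: "rsp_params \<Rightarrow> (real ^ 'n::finite) rsp_state \<Rightarrow> bool" where
  "valid_init P s \<longleftrightarrow>
     inj_on (dirs s) {..<CARD('n)} \<and> independent (dirs s ` {..<CARD('n)}) \<and>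
     gstep s > 0 \<and>
     (\<forall>j<CARD('n). lam_s P * gstep s \<le> steps s j \<and> steps s j \<le> lam_t P * gstep s)"

text \<open>The iterates \<open>x\<^sub>k\<^sub>j\<^sub>i\<close>, for \<open>i \<le> iterate_count P f s0 k j\<close>.\<close>

definition iterate ::
  "rsp_params \<Rightarrow> (real ^ 'n::{finite,linorder} \<Rightarrow> real) \<Rightarrow> (real ^ 'n::_) rsp_state
     \<Rightarrow> nat \<Rightarrow> nat \<Rightarrow> nat \<Rightarrow> real ^ 'n::_" where
  "iterate P f s0 k j i = fst (lm_state P f j (stage P f (run_state P f s0 k) j) i)"

definition iterate_count ::
  "rsp_params \<Rightarrow> (real ^ 'n::{finite,linorder} \<Rightarrow> real) \<Rightarrow> (real ^ 'n::_) rsp_state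
     \<Rightarrow> nat \<Rightarrow> nat \<Rightarrow> nat" where
  "iterate_count P f s0 k j = lm_count P f j (stage P f (run_state P f s0 k) j)"


section \<open>Termination of the line minimization\<close>

lemma rho_pos: "\<Delta> > 0 \<Longrightarrow> rho \<Delta> > 0"
proof -
  assume "\<Delta> > 0"
  moreover have "exp (1 / exp 1) > (0::real)" by simp
  ultimately show ?thesis
    unfolding rho_def by (smt (verit) powr_gt_zero)
qed

lemma search_state_step_pos:
  assumes "g \<ge> 1" "M > 0" "\<Delta> > 0"
  shows "snd (search_state g M v x \<Delta> i) > 0"
  using assms by (induction i) (auto split: prod.splits)

lemma search_state_step_Suc:
  assumes "g \<ge> 1" "M > 0" "\<Delta> > 0"
  shows "snd (search_state g M v x \<Delta> (Suc i)) = min (g ^ Suc i * \<Delta>) M"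
proof (induction i)
  case (Suc i)
  have "min (g * min (g ^ Suc i * \<Delta>) M) M = min (g ^ Suc (Suc i) * \<Delta>) M"
  proof (cases "g ^ Suc i * \<Delta> \<le> M")
    case True
    then show ?thesis by (simp add: mult.assoc)
  next
    case False
    have 1: "M \<le> g * M" using assms by simp
    have "0 < g ^ Suc i * \<Delta>" using assms by simp
    then have "g ^ Suc i * \<Delta> \<le> g * (g ^ Suc i * \<Delta>)" using assms by simp
    then have 2: "M \<le> g ^ Suc (Suc i) * \<Delta>" using False by (simp add: mult.assoc)
    show ?thesis using False 1 2 by (simp add: min_def)
  qed
  then show ?case using Suc by (simp split: prod.splits)
qed (auto split: prod.splits)

lemma search_terminates:
  assumes "bdd_below (range f)" "g \<ge> 1" "M > 0" "\<Delta> > 0"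
  shows "\<exists>i. \<not> accepts f v (search_state g M v x \<Delta> i)"
proof (rule ccontr)
  define S where "S = search_state g M v x \<Delta>"
  define D where "D = (\<lambda>i. snd (S i))"
  assume "\<not> ?thesis"
  then have acc: "accepts f v (S i)" for i by (auto simp: S_def)
  have D_pos: "D i > 0" for i
    using search_state_step_pos[OF assms(2-4)] by (simp add: D_def S_def)
  have D_Suc: "D (Suc i) = min (g ^ Suc i * \<Delta>) M" for i
    using search_state_step_Suc[OF assms(2-4)] unfolding D_def S_def by blast
  have "\<exists>N C. \<forall>i\<ge>N. D i = C"
  proof (cases "g = 1")
    case True
    have "D i = min \<Delta> M" if "i \<ge> 1" for i
      using that D_Suc[of "i - 1"] True by simp
    then show ?thesis by blast
  next
    case False
    then obtain N where N: "M / \<Delta> < g ^ N"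
      using real_arch_pow[of g "M / \<Delta>"] assms(2) by auto
    have "D i = M" if "i \<ge> Suc N" for i
    proof -
      have "g ^ N \<le> g ^ i" using that assms(2) by (intro power_increasing) auto
      then have "M / \<Delta> < g ^ i" using N by linarith
      then have "M < g ^ i * \<Delta>" using assms(4) by (simp add: field_simps)
      moreover have "Suc (i - 1) = i" using that by simp
      ultimately show ?thesis using D_Suc[of "i - 1"] by simp
    qed
    then show ?thesis by blast
  qed
  then obtain N C where NC: "\<And>i. i \<ge> N \<Longrightarrow> D i = C" by blast
  have drop: "f (fst (S (Suc i))) \<le> f (fst (S i)) - rho (D i)" for i
    using acc[of i] by (auto simp: accepts_def S_def D_def split: prod.splits)
  have dec: "f (fst (S (N + i))) \<le> f (fst (S N)) - real i * rho C" for i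
  proof (induction i)
    case (Suc i)
    have "f (fst (S (Suc (N + i)))) \<le> f (fst (S (N + i))) - rho C"
      using drop[of "N + i"] NC[of "N + i"] by simp
    then show ?case using Suc by (simp add: algebra_simps)
  qed simp
  obtain b where b: "\<And>y. b \<le> f y"
    using assms(1) by (auto simp: bdd_below_def)
  have "rho C > 0" using rho_pos D_pos[of N] NC[of N] by simp
  then obtain m :: nat where "real m * rho C > f (fst (S N)) - b"
    using reals_Archimedean3 by blast
  then show False using dec[of m] b[of "fst (S (N + m))"] by linarith
qed

end

theory Submission
  imports Defs
begin

text \<open>
  Every accepted step of size at least \<open>a > 0\<close> lowers \<open>f\<close> by an amount that depends only on \<open>a\<close>, so
  \<open>\<Phi>\<close> is reduced infinitely often and tends to \<open>0\<close>. A cycle that reduces \<open>\<Phi>\<close> ends at a point where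
  all trial steps \<open>\<plusminus> \<Delta>\<^sub>j d\<^sub>j\<close> fail. Since \<open>\<rho>(\<Delta>) / \<Delta> \<rightarrow> 0\<close>, the directions are bounded, and their
  determinant is bounded away from \<open>0\<close>, every limit point \<open>x\<close> of these points is critical, and \<open>f\<close>
  decreases to \<open>f x\<close> along the run.

  Suppose that \<open>x\<close> is a local maximum. As \<open>f\<close> never falls below \<open>f x\<close> along the run, the points close
  to \<open>x\<close> have the value \<open>f x\<close>; they are local maxima themselves, hence equal to \<open>x\<close> by isolation. So
  the run hits \<open>x\<close> exactly and stays there, with a fixed set of directions. On the line through \<open>x\<close>
  along one of them, \<open>f\<close> is a nonconstant power series with a strict maximum at \<open>x\<close>, so it falls off
  like a power of the step size, whereas \<open>\<rho>\<close> is smaller than every power: a small step is accepted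
  after all. Hence \<open>x\<close> is a global minimum.
\<close>

subsection \<open>The sufficient decrease function\<close>

lemma rho_eq_powr:
  assumes "t \<le> 1" "t \<noteq> 0"
  shows "rho t = t powr (1 / t)"
proof -
  have "(1::real) \<le> exp 1" by simp
  with assms(1) have "t \<le> exp 1" by (rule order_trans)
  with assms(2) show ?thesis by (simp add: rho_def)
qed

text \<open>The exponent \<open>1 / t\<close> is at least \<open>m + 1\<close> while the base
  \<open>t\<close> is at most 1, so near 0 \<open>rho\<close> lies below every power. This flatness
  is what the argument at analytic maxima rests on.\<close>

lemma rho_le_power:
  assumes "0 < t" "t \<le> 1 / real (Suc m)"
  shows "rho t \<le> t ^ Suc m"
proof -
  have t1: "t \<le> 1" using assms(2) by (smt (verit) divide_le_eq_1_pos of_nat_0_less_iff of_nat_Suc zero_less_Suc of_nat_0_le_iff)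
  have "real (Suc m) \<le> 1 / t" using assms by (simp add: field_simps)
  then have "t powr (1 / t) \<le> t powr real (Suc m)"
    using assms(1) t1 by (intro powr_mono') auto
  also have "\<dots> = t ^ Suc m" using assms(1) by (rule powr_realpow)
  finally show ?thesis
    using assms(1) rho_eq_powr[OF t1] by simp
qed

text \<open>Makes the decrease of an accepted step uniform over all step sizes from \<open>a\<close>
  on. Up to 1, both base and exponent of \<open>t powr (1 / t)\<close> compare favourably with those
  at \<open>a\<close>; beyond 1, both branches of \<open>rho\<close> are at least 1.\<close>

lemma rho_lower_bound:
  assumes "0 < a" "a \<le> t"
  shows "min 1 (a powr (1 / a)) \<le> rho t"
proof (cases "t \<le> 1")
  case True
  have "a powr (1 / a) \<le> a powr (1 / t)"
    using assms True by (intro powr_mono') (auto simp: field_simps)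
  also have "\<dots> \<le> t powr (1 / t)" using assms by (intro powr_mono2) auto
  finally show ?thesis
    using assms rho_eq_powr[OF True] by simp
next
  case False
  have "1 \<le> t powr (1 / t)" using False by (intro ge_one_powr_ge_zero) auto
  moreover have "1 \<le> exp (1 / exp (1::real))" by simp
  ultimately show ?thesis using False unfolding rho_def by (smt (verit))
qed

text \<open>For \<open>t\<close> below 1/2 the quadratic bound \<open>rho t \<le> t ^ 2\<close>
  squeezes the quotient between 0 and \<open>t\<close>. Hence the required decrease does not affect
  first-order conditions in the limit.\<close>

lemma tendsto_rho_div_0:
  assumes "T \<longlonglongrightarrow> 0" "\<And>m. 0 < T m"
  shows "(\<lambda>m. rho (T m) / T m) \<longlonglongrightarrow> 0"
proof (rule tendsto_sandwich[OF _ _ tendsto_const assms(1)])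
  show "\<forall>\<^sub>F m in sequentially. 0 \<le> rho (T m) / T m"
    using assms(2) rho_pos by (intro always_eventually) (simp add: less_imp_le)
  have "\<forall>\<^sub>F m in sequentially. T m < 1 / 2"
    using assms(1) by (rule order_tendstoD) simp
  then show "\<forall>\<^sub>F m in sequentially. rho (T m) / T m \<le> T m"
  proof eventually_elim
    case (elim m)
    then have "rho (T m) \<le> T m ^ Suc 1" using assms(2) by (intro rho_le_power) auto
    then show ?case using assms(2)[of m] by (simp add: field_simps power2_eq_square)
  qed
qed

subsection \<open>Analytic local maxima\<close>

text \<open>Let \<open>m\<close> be the first positive index with a nonzero coefficient. The
  quotient \<open>(g t - g 0) / t ^ m\<close> tends to \<open>a m\<close>, which is negative because
  0 is a maximum. So \<open>g\<close> falls at least like \<open>(- a m / 2) * t ^ m\<close>, and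
  \<open>rho\<close> is of smaller order.\<close>

lemma powser_strict_decrease_beats_rho:
  fixes a :: "nat \<Rightarrow> real"
  assumes "s > 0" "\<And>t. \<bar>t\<bar> < s \<Longrightarrow> (\<lambda>n. a n * t ^ n) sums g t"
    and "\<And>t. \<bar>t\<bar> < s \<Longrightarrow> g t \<le> g 0"
    and "\<exists>n>0. a n \<noteq> 0"
  shows "\<forall>\<^sub>F t in at_right 0. g t \<le> g 0 - rho t"
proof -
  define m where "m = (LEAST n. n > 0 \<and> a n \<noteq> 0)"
  have m: "m > 0" "a m \<noteq> 0" and least: "\<And>n. 0 < n \<Longrightarrow> n < m \<Longrightarrow> a n = 0"
    using LeastI_ex[OF assms(4)] not_less_Least[of _ "\<lambda>n. n > 0 \<and> a n \<noteq> 0"]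
    unfolding m_def by auto
  have g0: "g 0 = a 0" using assms(1) assms(2)[of 0] by simp
  define h where "h = (\<lambda>t. (g t - g 0) / t ^ m)"
  have sums_h: "(\<lambda>n. a (n + m) * t ^ n) sums h t" if "t \<noteq> 0" "norm t < s" for t
  proof -
    \<comment> \<open>By the choice of \<open>m\<close>, the initial segment of the series reduces
      to its constant term.\<close>
    have "(\<Sum>i<m. a i * t ^ i) = (\<Sum>i<m. if i = 0 then a 0 else 0)"
      using least by (intro sum.cong) auto
    also have "\<dots> = g 0" using m(1) by (subst sum.delta) (auto simp: g0)
    finally have "(\<lambda>n. a (n + m) * t ^ (n + m)) sums (g t - g 0)"
      using sums_split_initial_segment[OF assms(2)[of t], of m] that by simp
    from sums_divide[OF this, of "t ^ m"] show ?thesis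
      using that by (simp add: h_def power_add)
  qed
  have lim: "(h \<longlongrightarrow> a m) (at_right 0)"
    using powser_limit_0_strong[OF assms(1) sums_h] by (simp add: filterlim_at_split)
  have small: "\<forall>\<^sub>F t in at_right 0. 0 < t \<and> t < c" if "c > 0" for c :: real
    using that by (auto simp: eventually_at_right_field intro!: exI[of _ c])
  have "a m \<le> 0"
  proof (rule tendsto_upperbound[OF lim])
    show "\<forall>\<^sub>F t in at_right 0. h t \<le> 0"
      using small[OF assms(1)]
    proof eventually_elim
      case (elim t)
      then show ?case using assms(3)[of t] by (simp add: h_def divide_nonpos_pos)
    qed
  qed simp
  then have "a m < a m / 2" using m(2) by simp
  then have "\<forall>\<^sub>F t in at_right 0. h t < a m / 2" by (rule order_tendstoD[OF lim])
  \<comment> \<open>The bound \<open>1 / real (Suc m)\<close> gives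
    \<open>rho t \<le> t ^ Suc m\<close>; the bound \<open>- a m / 2\<close> absorbs the additional
    factor \<open>t\<close>.\<close>
  moreover have "\<forall>\<^sub>F t in at_right 0. 0 < t \<and> t < min (- a m / 2) (1 / real (Suc m))"
    using \<open>a m < a m / 2\<close> by (intro small) auto
  ultimately show ?thesis
  proof eventually_elim
    case (elim t)
    have "rho t \<le> t ^ Suc m" using elim by (intro rho_le_power) auto
    also have "\<dots> \<le> (- a m / 2) * t ^ m"
      using elim by (simp only: power_Suc) (intro mult_right_mono, auto)
    also have "\<dots> \<le> - h t * t ^ m" using elim by (intro mult_right_mono) auto
    also have "\<dots> = g 0 - g t" using elim by (simp add: h_def)
    finally show ?case by simp
  qed
qed

text \<open>On a line, every monomial of total degree \<open>n\<close> contributes a multiple of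
  \<open>t ^ n\<close>. Each degree has only finitely many multi-indices, and \<open>has_sum\<close>
  is unconditional, so the series may be summed degree by degree.\<close>

lemma real_analytic_at_line:
  fixes f :: "real ^ 'n::finite \<Rightarrow> real"
  assumes "real_analytic_at f x"
  obtains s a where "s > 0" "\<And>t. \<bar>t\<bar> < s \<Longrightarrow> (\<lambda>n. a n * t ^ n) sums f (x + t *\<^sub>R d)"
proof -
  obtain c :: "('n \<Rightarrow> nat) \<Rightarrow> real" and r where r: "r > 0"
    and c: "\<And>y. y \<in> ball x r \<Longrightarrow> ((\<lambda>m. c m * (\<Prod>i\<in>UNIV. (y $ i - x $ i) ^ m i)) has_sum f y) UNIV"
    using assms unfolding real_analytic_at_def by blast
  define deg where "deg = (\<lambda>m :: 'n \<Rightarrow> nat. \<Sum>i\<in>UNIV. m i)"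
  define H where "H = (\<lambda>n. {m. deg m = n})"
  have finH: "finite (H n)" for n
  proof (rule finite_subset)
    show "H n \<subseteq> PiE UNIV (\<lambda>_. {..n})"
      by (auto simp: H_def deg_def PiE_def intro: member_le_sum)
  qed (auto intro: finite_PiE)
  define a where "a = (\<lambda>n. \<Sum>m\<in>H n. c m * (\<Prod>i\<in>UNIV. (d $ i) ^ m i))"
  \<comment> \<open>The summand 1 in the denominator keeps the radius well defined for
    \<open>d = 0\<close>.\<close>
  have "(\<lambda>n. a n * t ^ n) sums f (x + t *\<^sub>R d)" if t: "\<bar>t\<bar> < r / (norm d + 1)" for t
  proof -
    have "\<bar>t\<bar> * norm d \<le> \<bar>t\<bar> * (norm d + 1)" by (intro mult_left_mono) auto
    also have "\<dots> < r" using t by (simp add: pos_less_divide_eq add_nonneg_pos)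
    finally have "x + t *\<^sub>R d \<in> ball x r" by (simp add: dist_norm)
    from c[OF this] have *: "((\<lambda>m. c m * (\<Prod>i\<in>UNIV. (d $ i) ^ m i) * t ^ deg m) has_sum f (x + t *\<^sub>R d)) UNIV"
      by (simp add: power_mult_distrib prod.distrib deg_def power_sum mult_ac)
    \<comment> \<open>Tagging each multi-index with its degree turns the index set into a disjoint
      union of the finite sets \<open>H n\<close>.\<close>
    have "((\<lambda>p. c (snd p) * (\<Prod>i\<in>UNIV. (d $ i) ^ snd p i) * t ^ fst p) has_sum f (x + t *\<^sub>R d)) (Sigma UNIV H)"
      by (rule iffD1[OF has_sum_reindex_bij_witness[where j = "\<lambda>m. (deg m, m)" and i = snd] *])
        (auto simp: H_def)
    moreover have "((\<lambda>m. c (snd (n, m)) * (\<Prod>i\<in>UNIV. (d $ i) ^ snd (n, m) i) * t ^ fst (n, m)) has_sum a n * t ^ n) (H n)" for n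
      using finH[of n] by (intro has_sum_finiteI) (auto simp: a_def sum_distrib_right)
    ultimately have "((\<lambda>n. a n * t ^ n) has_sum f (x + t *\<^sub>R d)) UNIV"
      by (rule has_sum_SigmaD)
    then show ?thesis by (rule has_sum_imp_sums)
  qed
  moreover have "r / (norm d + 1) > 0" using r by (simp add: add_nonneg_pos)
  ultimately show ?thesis using that by blast
qed

text \<open>Isolation only excludes other local maxima; this lemma lets it exclude nearby points of
  equal value as well.\<close>

lemma local_maximum_of_equal_value:
  assumes "\<forall>y\<in>ball x e. f y \<le> f x" "z \<in> ball x e" "f z = f x"
  shows "local_maximum f z"
  unfolding local_maximum_def
proof (intro exI conjI ballI)
  show "e - dist x z > 0" using assms(2) by simp
  fix y assume "y \<in> ball z (e - dist x z)"
  then have "y \<in> ball x e" using dist_triangle[of x y z] by (simp add: dist_commute)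
  then show "f y \<le> f z" using assms by auto
qed

lemma isolated_analytic_maximum_decrease:
  fixes f :: "real ^ 'n::finite \<Rightarrow> real"
  assumes "local_maximum f x" "x isolated_in {z. local_maximum f z}" "real_analytic_at f x" "d \<noteq> 0"
  shows "\<forall>\<^sub>F t in at_right 0. f (x + t *\<^sub>R d) \<le> f x - rho t"
proof -
  obtain s a where s: "s > 0" and a: "\<And>t. \<bar>t\<bar> < s \<Longrightarrow> (\<lambda>n. a n * t ^ n) sums f (x + t *\<^sub>R d)"
    using real_analytic_at_line[OF assms(3), where d = d] by blast
  obtain e where e: "e > 0" "\<forall>y\<in>ball x e. f y \<le> f x"
    using assms(1) unfolding local_maximum_def by blast
  obtain e' where e': "e' > 0" "\<And>y. local_maximum f y \<Longrightarrow> dist x y < e' \<Longrightarrow> y = x"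
    using isolated_inE_dist[OF assms(2)] by (metis mem_Collect_eq)
  \<comment> \<open>Short enough for the series to converge and for the segment to stay in the balls
    of maximality and of isolation.\<close>
  define s' where "s' = min s (min e e' / norm d)"
  have s': "s' > 0" using s e(1) e'(1) assms(4) by (simp add: s'_def)
  have close: "dist x (x + t *\<^sub>R d) < min e e'" if "\<bar>t\<bar> < s'" for t
    using that assms(4) by (simp add: s'_def dist_norm pos_less_divide_eq)
  \<comment> \<open>Otherwise \<open>f\<close> would be constant on a segment through
    \<open>x\<close>, whose points near \<open>x\<close> would be further local maxima.\<close>
  have "\<exists>n>0. a n \<noteq> 0"
  proof (rule ccontr)
    assume "\<not> ?thesis"
    then have "a n = 0" if "n > 0" for n using that by blast
    then have a0: "a n = (if n = 0 then a 0 else 0)" for n by simp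
    have const: "f (x + t *\<^sub>R d) = a 0" if "\<bar>t\<bar> < s" for t
    proof -
      have "(\<lambda>n. a n * t ^ n) = (\<lambda>n. if n = 0 then a 0 else 0)"
        by (rule ext, subst a0) simp
      then have "(\<lambda>n. a n * t ^ n) sums a 0" using sums_single[of 0 "\<lambda>_. a 0"] by simp
      then show ?thesis using a[OF that] sums_unique2 by blast
    qed
    define t where "t = s' / 2"
    have t: "0 < t" "\<bar>t\<bar> < s'" using s' by (auto simp: t_def)
    then have "\<bar>t\<bar> < s" by (simp add: s'_def)
    then have "f (x + t *\<^sub>R d) = f x" using const[of t] const[of 0] s by simp
    then have "local_maximum f (x + t *\<^sub>R d)"
      using local_maximum_of_equal_value[OF e(2)] close[OF t(2)] by simp
    then have "x + t *\<^sub>R d = x" by (rule e'(2)) (use close[OF t(2)] in simp)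
    then show False using t assms(4) by simp
  qed
  then have "\<forall>\<^sub>F t in at_right 0. f (x + t *\<^sub>R d) \<le> f (x + 0 *\<^sub>R d) - rho t"
    using s' a e(2) close
    by (intro powser_strict_decrease_beats_rho[of s' a "\<lambda>t. f (x + t *\<^sub>R d)"])
      (auto simp: s'_def)
  then show ?thesis by simp
qed

subsection \<open>Critical limit points\<close>

text \<open>By the mean value theorem the difference quotient is a directional derivative at an
  intermediate point. It is at least \<open>- rho (T m) / T m\<close>, which tends to 0, and
  continuity of the gradient carries the inequality to the limit even though points and directions
  vary.\<close>

lemma gradient_inner_limit_nonneg:
  fixes f :: "'a::real_inner \<Rightarrow> real"
  assumes "\<And>x. GDERIV f x :> g x" "continuous_on UNIV g"
    and "X \<longlonglongrightarrow> x" "V \<longlonglongrightarrow> v" "T \<longlonglongrightarrow> 0" "\<And>m. 0 < T m"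
    and ge: "\<And>m. f (X m) - rho (T m) \<le> f (X m + T m *\<^sub>R V m)"
  shows "0 \<le> g x \<bullet> v"
proof -
  have "\<exists>s. 0 < s \<and> s < T m \<and> f (X m + T m *\<^sub>R V m) - f (X m) = T m * (g (X m + s *\<^sub>R V m) \<bullet> V m)" for m
  proof -
    have deriv: "DERIV (\<lambda>t. f (X m + t *\<^sub>R V m)) t :> g (X m + t *\<^sub>R V m) \<bullet> V m" for t
    proof -
      have "((\<lambda>t. f (X m + t *\<^sub>R V m)) has_derivative (\<lambda>h. (h *\<^sub>R V m) \<bullet> g (X m + t *\<^sub>R V m))) (at t)"
      proof -
        have line: "((\<lambda>t. X m + t *\<^sub>R V m) has_derivative (\<lambda>h. h *\<^sub>R V m)) (at t)"
          by (auto intro!: derivative_eq_intros)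
        have "(f has_derivative (\<lambda>h. h \<bullet> g (X m + t *\<^sub>R V m))) (at (X m + t *\<^sub>R V m))"
          using assms(1) by (simp add: gderiv_def)
        then show ?thesis by (rule has_derivative_compose[OF line])
      qed
      moreover have "(\<lambda>h. (h *\<^sub>R V m) \<bullet> g (X m + t *\<^sub>R V m)) = (*) (g (X m + t *\<^sub>R V m) \<bullet> V m)"
        by (rule ext) (simp add: inner_commute[of "V m"])
      ultimately show ?thesis by (simp only: has_field_derivative_def)
    qed
    have "\<exists>s>0. s < T m \<and> f (X m + T m *\<^sub>R V m) - f (X m + 0 *\<^sub>R V m) = (T m - 0) * (g (X m + s *\<^sub>R V m) \<bullet> V m)"
      by (rule MVT2[OF assms(6)]) (rule deriv)
    then show ?thesis by (simp only: scaleR_zero_left add_0_right diff_zero)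
  qed
  then have "\<exists>S. \<forall>m. 0 < S m \<and> S m < T m \<and>
      f (X m + T m *\<^sub>R V m) - f (X m) = T m * (g (X m + S m *\<^sub>R V m) \<bullet> V m)"
    by (intro choice allI)
  then obtain S where S: "\<And>m. 0 < S m" "\<And>m. S m < T m"
    and eq: "\<And>m. f (X m + T m *\<^sub>R V m) - f (X m) = T m * (g (X m + S m *\<^sub>R V m) \<bullet> V m)"
    by blast
  have "S \<longlonglongrightarrow> 0"
    by (rule tendsto_sandwich[OF _ _ tendsto_const assms(5)])
       (simp_all add: S less_imp_le)
  then have "(\<lambda>m. X m + S m *\<^sub>R V m) \<longlonglongrightarrow> x + 0 *\<^sub>R v" by (intro tendsto_intros assms)
  then have "(\<lambda>m. g (X m + S m *\<^sub>R V m)) \<longlonglongrightarrow> g x"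
    using assms(2) by (auto intro: continuous_on_tendsto_compose)
  then have "(\<lambda>m. g (X m + S m *\<^sub>R V m) \<bullet> V m) \<longlonglongrightarrow> g x \<bullet> v" by (intro tendsto_intros assms)
  moreover have "(\<lambda>m. - (rho (T m) / T m)) \<longlonglongrightarrow> - 0"
    by (intro tendsto_minus tendsto_rho_div_0 assms)
  moreover have "- (rho (T m) / T m) \<le> g (X m + S m *\<^sub>R V m) \<bullet> V m" for m
  proof -
    have "- rho (T m) \<le> T m * (g (X m + S m *\<^sub>R V m) \<bullet> V m)"
      using ge[of m] eq[of m] by linarith
    then show ?thesis using assms(6)[of m] by (simp add: field_simps)
  qed
  ultimately have "- 0 \<le> g x \<bullet> v" by (intro LIMSEQ_le) auto
  then show ?thesis by simp
qed

text \<open>The points of a sublevel set at distance at least \<open>e\<close> from the minima form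
  a compact set. If it is nonempty, its least value of \<open>f\<close> exceeds the global minimum,
  and the gap supplies \<delta>.\<close>

lemma infdist_global_minima_sublevel:
  fixes f :: "'a::metric_space \<Rightarrow> real"
  assumes "continuous_on UNIV f" "\<And>c. compact {x. f x \<le> c}" "e > 0" "x0 \<in> global_minima f"
  obtains \<delta> where "\<delta> > 0" "\<And>x. f x < f x0 + \<delta> \<Longrightarrow> infdist x (global_minima f) < e"
proof -
  \<comment> \<open>The 1 is an arbitrary cap that makes the set compact.\<close>
  define C where "C = {x. f x \<le> f x0 + 1} \<inter> {x. e \<le> infdist x (global_minima f)}"
  have "closed {x. e \<le> infdist x (global_minima f)}"
    by (intro closed_Collect_le continuous_intros)
  then have C: "compact C" unfolding C_def using assms(2) by (intro compact_Int_closed)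
  show ?thesis
  proof (cases "C = {}")
    case True
    have "infdist x (global_minima f) < e" if "f x < f x0 + 1" for x
    proof (rule ccontr)
      assume "\<not> ?thesis"
      then have "x \<in> C" using that by (simp add: C_def)
      then show False using True by simp
    qed
    then show ?thesis using that[of 1] by simp
  next
    case False
    then obtain z where z: "z \<in> C" "\<And>y. y \<in> C \<Longrightarrow> f z \<le> f y"
      using continuous_attains_inf[OF C] assms(1) by (meson continuous_on_subset subset_UNIV)
    have "z \<notin> global_minima f" using z(1) assms(3) by (auto simp: C_def)
    then have "f x0 < f z"
      using assms(4) unfolding global_minima_def by (smt (verit) mem_Collect_eq)
    have "infdist x (global_minima f) < e" if "f x < f x0 + min 1 (f z - f x0)" for x
    proof (rule ccontr)
      assume "\<not> ?thesis"
      moreover have "f x < f x0 + 1" "f x < f z" using that by linarith+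
      ultimately show False using z(2)[of x] by (simp add: C_def)
    qed
    then show ?thesis
      using \<open>f x0 < f z\<close> that[of "min 1 (f z - f x0)"] by simp
  qed
qed

subsection \<open>Matrices of directions\<close>

definition ord_index :: "'n::{finite,linorder} \<Rightarrow> nat" where
  "ord_index j = card {k. k < j}"

lemma bij_betw_ord_index: "bij_betw ord_index (UNIV :: 'n::{finite,linorder} set) {..<CARD('n)}"
proof -
  have lt: "ord_index i < ord_index j" if "i < j" for i j :: 'n
    unfolding ord_index_def using that by (intro psubset_card_mono) auto
  have inj: "inj (ord_index :: 'n \<Rightarrow> nat)"
    by (rule linorder_injI) (use lt in \<open>metis less_irrefl\<close>)
  have "ord_index j < CARD('n)" for j :: 'n
    unfolding ord_index_def by (intro psubset_card_mono) auto
  then have "ord_index ` (UNIV :: 'n set) \<subseteq> {..<CARD('n)}" by auto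
  moreover have "card (ord_index ` (UNIV :: 'n set)) = card {..<CARD('n)}"
    using inj by (simp add: card_image)
  ultimately have "ord_index ` (UNIV :: 'n set) = {..<CARD('n)}"
    by (intro card_subset_eq) auto
  then show ?thesis using inj by (simp add: bij_betw_def)
qed

lemma ord_index_less: "ord_index (j :: 'n::{finite,linorder}) < CARD('n)"
  using bij_betw_ord_index[where 'n = 'n] by (auto simp: bij_betw_def)

lemma ex_ord_index:
  assumes "m < CARD('n)"
  obtains j :: "'n::{finite,linorder}" where "ord_index j = m"
  using bij_betw_ord_index[where 'n = 'n] assms unfolding bij_betw_def by (metis imageE lessThan_iff)

definition columns_matrix :: "(nat \<Rightarrow> real ^ 'n::{finite,linorder}) \<Rightarrow> real ^ 'n::_ ^ 'n::_" where
  "columns_matrix c = (\<chi> i j. c (ord_index j) $ i)"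

lemma det_columns_eq: "det_columns c = det (columns_matrix c)"
  by (simp add: det_columns_def columns_matrix_def ord_index_def)

lemma column_columns_matrix: "column j (columns_matrix c) = c (ord_index j)"
  by (simp add: column_def columns_matrix_def vec_eq_iff)

text \<open>The inner products are the entries of \<open>transpose A *v g\<close>, and the transpose
  is invertible too.\<close>

lemma eq_0_if_inner_columns:
  fixes A :: "real ^ 'n ^ 'n"
  assumes "det A \<noteq> 0" "\<And>j. g \<bullet> column j A = 0"
  shows "g = 0"
proof -
  have "transpose A *v g = 0"
    using assms(2) by (simp add: matrix_vector_mult_def transpose_def vec_eq_iff inner_vec_def column_def mult.commute)
  moreover have "invertible (transpose A)"
    using assms(1) by (simp add: invertible_det_nz)
  ultimately show ?thesis
    by (metis invertible_def matrix_vector_mul_assoc matrix_vector_mul_lid matrix_vector_mult_0_right)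
qed

lemma tendsto_det:
  fixes X :: "'b \<Rightarrow> 'a::real_normed_field ^ 'n ^ 'n"
  assumes "(X \<longlongrightarrow> A) F"
  shows "((\<lambda>m. det (X m)) \<longlongrightarrow> det A) F"
  unfolding det_def
  by (intro tendsto_sum tendsto_mult tendsto_const tendsto_prod tendsto_vec_nth assms)

text \<open>\<open>independent\<close> speaks of a set and cannot see a repeated direction;
  injectivity turns it into independence of the family of columns.\<close>

lemma det_columns_nonzero:
  fixes d :: "nat \<Rightarrow> real ^ 'n::{finite,linorder}"
  assumes "inj_on d {..<CARD('n)}" "independent (d ` {..<CARD('n)})"
  shows "det_columns d \<noteq> 0"
proof -
  let ?h = "\<lambda>j::'n. d (ord_index j)"
  have rng: "range ?h = d ` {..<CARD('n)}"
    using bij_betw_ord_index[where 'n = 'n] by (simp add: bij_betw_def image_image[symmetric])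
  have inj: "inj ?h"
  proof (rule injI)
    fix i j assume "?h i = ?h j"
    then have "ord_index i = ord_index j"
      by (rule inj_onD[OF assms(1)]) (simp_all add: ord_index_less)
    then show "i = j"
      by (rule inj_onD[OF bij_betw_imp_inj_on[OF bij_betw_ord_index]]) simp_all
  qed
  have "\<forall>i. u i = 0" if "(\<Sum>i\<in>UNIV. u i *s column i (columns_matrix d)) = 0" for u
  proof -
    \<comment> \<open>Coefficients indexed by columns are transported to coefficients indexed by
      vectors.\<close>
    have "(\<Sum>v\<in>range ?h. u (inv ?h v) *\<^sub>R v) = (\<Sum>i\<in>UNIV. u i *\<^sub>R ?h i)"
      using inj by (subst sum.reindex) (simp_all add: inv_f_f[OF inj])
    also have "\<dots> = 0" using that by (simp add: column_columns_matrix scalar_mult_eq_scaleR)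
    finally have "\<forall>v\<in>range ?h. u (inv ?h v) = 0"
      using assms(2) unfolding rng[symmetric] by (auto simp: independent_explicit)
    then show ?thesis by (simp add: inv_f_f[OF inj])
  qed
  then have "\<exists>B. B ** columns_matrix d = mat 1"
    by (subst matrix_left_invertible_independent_columns) blast
  then show ?thesis
    by (simp add: det_columns_eq invertible_det_nz[symmetric] invertible_left_inverse)
qed

lemma det_columns_eq_0:
  fixes d :: "nat \<Rightarrow> real ^ 'n::{finite,linorder}"
  assumes "m < CARD('n)" "d m = 0"
  shows "det_columns d = 0"
proof -
  obtain j :: 'n where j: "ord_index j = m" using ex_ord_index[OF assms(1)] by blast
  have "row j (transpose (columns_matrix d)) = 0"
    using assms(2) j by (simp add: row_transpose column_columns_matrix)
  then have "det (transpose (columns_matrix d)) = 0" by (rule det_zero_row)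
  then show ?thesis by (simp add: det_columns_eq det_transpose)
qed

text \<open>The cyclic shift is a permutation of the columns and may flip the sign, so only the
  absolute value is invariant.\<close>

lemma abs_det_columns_rotate:
  fixes d :: "nat \<Rightarrow> real ^ 'n::{finite,linorder}"
  shows "\<bar>det_columns (shift_last CARD('n) d (d 0))\<bar> = \<bar>det_columns d\<bar>"
proof -
  \<comment> \<open>The shift acts on column numbers; \<open>p\<close> is the corresponding
    permutation of the index type.\<close>
  define rot where "rot = (\<lambda>m. if m < CARD('n) - 1 then Suc m else 0)"
  define p :: "'n \<Rightarrow> 'n" where "p = (\<lambda>j. inv ord_index (rot (ord_index j)))"
  have inj: "inj (ord_index :: 'n \<Rightarrow> nat)" and rng: "range (ord_index :: 'n \<Rightarrow> nat) = {..<CARD('n)}"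
    using bij_betw_ord_index[where 'n = 'n] by (auto simp: bij_betw_def)
  have rotlt: "rot m < CARD('n)" for m by (auto simp: rot_def)
  have op: "ord_index (p j) = rot (ord_index j)" for j
    unfolding p_def using rotlt rng by (intro f_inv_into_f) auto
  have "inj p"
  proof (rule injI)
    fix i j assume "p i = p j"
    then have "rot (ord_index i) = rot (ord_index j)" by (metis op)
    then have "ord_index i = ord_index j"
      using ord_index_less[of i] ord_index_less[of j] by (auto simp: rot_def split: if_splits)
    then show "i = j" by (rule injD[OF inj])
  qed
  then have "bij p" using finite_UNIV_inj_surj[of p] by (simp only: bij_def finite simp_thms)
  then have perm: "p permutes UNIV" by (rule bij_imp_permutes) simp
  have "columns_matrix (shift_last CARD('n) d (d 0)) = (\<chi> i j. columns_matrix d $ i $ p j)"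
    by (simp add: columns_matrix_def vec_eq_iff op shift_last_def rot_def)
  then have "det_columns (shift_last CARD('n) d (d 0)) = of_int (sign p) * det_columns d"
    by (simp add: det_columns_eq det_permute_columns[OF perm])
  then show ?thesis by (simp add: abs_mult sign_def)
qed

subsection \<open>Line minimization\<close>

lemma search_state_fst:
  "fst (search_state g M v x \<Delta> i) = x + (\<Sum>l<i. snd (search_state g M v x \<Delta> l)) *\<^sub>R v"
  by (induction i) (auto split: prod.splits simp: scaleR_left_distrib)

lemma search_state_snd_bounds:
  assumes "g \<ge> 1" "0 < L" "L \<le> \<Delta>" "\<Delta> \<le> M"
  shows "L \<le> snd (search_state g M v x \<Delta> i) \<and> snd (search_state g M v x \<Delta> i) \<le> M"
proof (induction i)
  case (Suc i)
  define D where "D = snd (search_state g M v x \<Delta> i)"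
  have D: "L \<le> D" "D \<le> M" using Suc by (auto simp: D_def)
  then have "1 * D \<le> g * D" using assms by (intro mult_right_mono) auto
  then show ?case using D by (auto split: prod.splits simp: D_def)
qed (use assms in auto)

definition step_bounds :: "rsp_params \<Rightarrow> 'v rsp_state \<Rightarrow> nat \<Rightarrow> bool" where
  "step_bounds P s j \<longleftrightarrow> gstep s > 0 \<and>
     lam_s P * gstep s \<le> steps s j \<and> steps s j \<le> lam_t P * gstep s"

lemma line_min_simps [simp]:
  "dirs (line_min P f j s) = dirs s" "gstep (line_min P f j s) = gstep s"
  by (simp_all add: line_min_def)

context
  fixes P :: rsp_params and f :: "'v::real_vector \<Rightarrow> real" and s :: "'v rsp_state" and j :: nat
  assumes valid: "valid_params P" and bdd: "bdd_below (range f)" and bounds: "step_bounds P s j"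
begin

lemma step_size_pos: "0 < lam_s P * gstep s" "0 < steps s j" "0 < lam_t P * gstep s"
proof -
  show *: "0 < lam_s P * gstep s" using valid bounds by (simp add: valid_params_def step_bounds_def)
  then show "0 < steps s j" using bounds by (simp add: step_bounds_def)
  then show "0 < lam_t P * gstep s" using bounds by (simp add: step_bounds_def)
qed

lemma lm_state_snd_bounds:
  "lam_s P * gstep s \<le> snd (lm_state P f j s i) \<and> snd (lm_state P f j s i) \<le> lam_t P * gstep s"
  unfolding lm_state_def
  using valid bounds step_size_pos by (intro search_state_snd_bounds) (auto simp: valid_params_def step_bounds_def)

lemma lm_accepts: "i < lm_count P f j s \<Longrightarrow> accepts f (lm_sign P f j s *\<^sub>R dirs s j) (lm_state P f j s i)"
  unfolding lm_count_def search_steps_def lm_state_def by (drule not_less_Least) simp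

text \<open>A \<open>LEAST\<close> has its defining property only if a witness exists; termination
  of the search provides one.\<close>

lemma lm_stops: "\<not> accepts f (lm_sign P f j s *\<^sub>R dirs s j) (lm_state P f j s (lm_count P f j s))"
  unfolding lm_count_def search_steps_def lm_state_def
  by (rule LeastI_ex[OF search_terminates[OF bdd _ step_size_pos(3,2)]])
    (use valid in \<open>simp add: valid_params_def\<close>)

lemma lm_state_decrease:
  assumes "i < lm_count P f j s"
  shows "f (fst (lm_state P f j s (Suc i))) \<le> f (fst (lm_state P f j s i)) - rho (snd (lm_state P f j s i))"
  using lm_accepts[OF assms] by (auto simp: accepts_def lm_state_def split: prod.splits)

lemma lm_state_le_Suc:
  assumes "i < lm_count P f j s"
  shows "f (fst (lm_state P f j s (Suc i))) \<le> f (fst (lm_state P f j s i))"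
proof -
  have "0 < rho (snd (lm_state P f j s i))"
    using lm_state_snd_bounds[of i] step_size_pos by (intro rho_pos) auto
  then show ?thesis using lm_state_decrease[OF assms] by simp
qed

lemma lm_state_le:
  assumes "k \<le> i" "i \<le> lm_count P f j s"
  shows "f (fst (lm_state P f j s i)) \<le> f (fst (lm_state P f j s k))"
  using assms
proof (induction rule: dec_induct)
  case (step m)
  then show ?case using lm_state_le_Suc[of m] by linarith
qed simp

lemma fst_lm_state_0: "fst (lm_state P f j s 0) = pt s"
  by (simp add: lm_state_def)

lemma pt_line_min: "pt (line_min P f j s) = fst (lm_state P f j s (lm_count P f j s))"
  by (simp add: line_min_def lm_alpha_def lm_state_def search_state_fst mult.commute)

text \<open>All steps of one search have the same sign and positive length, so they cannot
  cancel.\<close>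

lemma lm_alpha_eq_0_iff: "lm_alpha P f j s = 0 \<longleftrightarrow> lm_count P f j s = 0"
proof -
  have pos: "0 < snd (lm_state P f j s i)" for i
    using lm_state_snd_bounds[of i] step_size_pos by simp
  then have "(\<Sum>i<lm_count P f j s. snd (lm_state P f j s i)) = 0 \<longleftrightarrow> lm_count P f j s = 0"
    by (subst sum_nonneg_eq_0_iff) (auto simp: less_imp_le less_imp_neq[symmetric])
  then show ?thesis by (simp add: lm_alpha_def lm_sign_def)
qed

lemma f_line_min_le: "f (pt (line_min P f j s)) \<le> f (pt s)"
  using lm_state_le[of 0 "lm_count P f j s"] by (simp add: pt_line_min fst_lm_state_0)

text \<open>The first accepted step already gives this decrease, and later steps never raise
  \<open>f\<close>.\<close>

lemma f_line_min_decrease: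
  assumes "lm_alpha P f j s \<noteq> 0" "0 < a" "a \<le> lam_s P * gstep s"
  shows "f (pt (line_min P f j s)) \<le> f (pt s) - min 1 (a powr (1 / a))"
proof -
  have pos: "0 < lm_count P f j s" using assms(1) by (simp add: lm_alpha_eq_0_iff)
  have "f (pt (line_min P f j s)) \<le> f (fst (lm_state P f j s (Suc 0)))"
    using lm_state_le[of "Suc 0" "lm_count P f j s"] pos by (simp add: pt_line_min)
  also have "\<dots> \<le> f (pt s) - rho (snd (lm_state P f j s 0))"
    using lm_state_decrease[OF pos] by (simp add: fst_lm_state_0)
  also have "\<dots> \<le> f (pt s) - min 1 (a powr (1 / a))"
    using lm_state_snd_bounds[of 0] assms(3)
    by (intro diff_left_mono rho_lower_bound[OF assms(2)]) auto
  finally show ?thesis .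
qed

lemma line_min_no_improvement:
  assumes "lm_alpha P f j s = 0" "\<sigma> = 1 \<or> \<sigma> = - 1"
  shows "f (pt s) - rho (steps s j) < f (pt s + steps s j *\<^sub>R (\<sigma> *\<^sub>R dirs s j))"
proof -
  have "\<not> accepts f (lm_sign P f j s *\<^sub>R dirs s j) (pt s, steps s j)"
    using lm_stops assms(1) by (simp add: lm_alpha_eq_0_iff lm_state_def)
  then have "\<not> accepts f (dirs s j) (pt s, steps s j)" "\<not> accepts f (- dirs s j) (pt s, steps s j)"
    by (auto simp: lm_sign_def split: if_splits)
  then show ?thesis using assms(2) by (auto simp: accepts_def)
qed

lemma step_bounds_line_min:
  assumes "step_bounds P s i"
  shows "step_bounds P (line_min P f j s) i"
proof (cases "i = j \<and> lm_alpha P f j s = 0")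
  case True
  have "theta_par P * steps s j \<le> 1 * steps s j"
    using valid step_size_pos by (intro mult_right_mono) (auto simp: valid_params_def)
  moreover have "lam_s P * gstep s \<le> lam_t P * gstep s"
    using bounds unfolding step_bounds_def by linarith
  ultimately show ?thesis using True bounds by (auto simp: step_bounds_def line_min_def)
next
  case False
  then show ?thesis
    using assms lm_state_snd_bounds by (auto simp: step_bounds_def line_min_def)
qed

end

subsection \<open>One cycle\<close>

text \<open>The condition for reducing \<Phi>. It leaves out the preliminary line minimization,
  which may move the point even in a stalled cycle.\<close>

definition stalled :: "rsp_params \<Rightarrow> (real ^ 'n::finite \<Rightarrow> real) \<Rightarrow> (real ^ 'n) rsp_state \<Rightarrow> bool" where
  "stalled P f s \<longleftrightarrow> (\<forall>j<CARD('n). cycle_alpha P f s j = 0)"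

definition admissible :: "rsp_params \<Rightarrow> (real ^ 'n::finite) rsp_state \<Rightarrow> bool" where
  "admissible P s \<longleftrightarrow> (\<forall>j<CARD('n). step_bounds P s j)"

lemma stage_simps [simp]:
  "dirs (stage P f s j) = dirs s" "gstep (stage P f s j) = gstep s"
  by (induction j) simp_all

lemma pt_stage_Suc: "pt (stage P f s (Suc j)) = pt (stage P f s j) + cycle_alpha P f s j *\<^sub>R dirs s j"
  by (simp add: line_min_def cycle_alpha_def)

lemma pt_stage_eq:
  "pt (stage P f s j) = pt (stage P f s 0) + (\<Sum>i<j. cycle_alpha P f s i *\<^sub>R dirs s i)"
proof (induction j)
  case (Suc j)
  then show ?case unfolding pt_stage_Suc by (simp add: add.assoc)
qed simp

context
  fixes P :: rsp_params and f :: "real ^ 'n::{finite,linorder} \<Rightarrow> real" and s :: "(real ^ 'n::_) rsp_state"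
  assumes valid: "valid_params P" and bdd: "bdd_below (range f)"
    and adm: "admissible P s"
begin

lemma bounds: "j < CARD('n) \<Longrightarrow> step_bounds P s j"
  using adm by (simp add: admissible_def)

lemma step_bounds_stage:
  assumes "j \<le> CARD('n)" "i < CARD('n)"
  shows "step_bounds P (stage P f s j) i"
  using assms
proof (induction j arbitrary: i)
  case 0
  then show ?case using bounds by (auto intro!: step_bounds_line_min[OF valid bdd])
next
  case (Suc j)
  then show ?case by (auto intro!: step_bounds_line_min[OF valid bdd])
qed

lemma f_stage_0_le: "f (pt (stage P f s 0)) \<le> f (pt s)"
  using bounds by (auto intro!: f_line_min_le[OF valid bdd])

lemma f_stage_mono:
  assumes "i \<le> j" "j \<le> CARD('n)"
  shows "f (pt (stage P f s j)) \<le> f (pt (stage P f s i))"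
  using assms
proof (induction rule: dec_induct)
  case (step m)
  have "f (pt (stage P f s (Suc m))) \<le> f (pt (stage P f s m))"
    using step.prems step_bounds_stage by (auto intro!: f_line_min_le[OF valid bdd])
  then show ?case using step by auto
qed simp

lemma f_cycle_le_stage: "j \<le> CARD('n) \<Longrightarrow> f (pt (rsp_cycle P f s)) \<le> f (pt (stage P f s j))"
  using f_stage_mono[of j "CARD('n)"] by (simp add: rsp_cycle_def)

lemma f_stage_le: "j \<le> CARD('n) \<Longrightarrow> f (pt (stage P f s j)) \<le> f (pt s)"
  using f_stage_mono[of 0 j] f_stage_0_le by simp

lemma f_cycle_decrease:
  assumes "\<not> stalled P f s" "0 < a" "a \<le> lam_s P * gstep s"
  shows "f (pt (rsp_cycle P f s)) \<le> f (pt s) - min 1 (a powr (1 / a))"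
proof -
  obtain j where j: "j < CARD('n)" "cycle_alpha P f s j \<noteq> 0" using assms(1) by (auto simp: stalled_def)
  have "f (pt (rsp_cycle P f s)) \<le> f (pt (stage P f s (Suc j)))"
    using j by (intro f_cycle_le_stage) auto
  also have "\<dots> \<le> f (pt (stage P f s j)) - min 1 (a powr (1 / a))"
    using j assms step_bounds_stage[of j j]
    by (auto simp: cycle_alpha_def intro!: f_line_min_decrease[OF valid bdd])
  also have "\<dots> \<le> f (pt s) - min 1 (a powr (1 / a))"
    using j f_stage_le[of j] by simp
  finally show ?thesis .
qed

lemma pt_stage_0_eq:
  assumes "f (pt s) \<le> f (pt (stage P f s 0))"
  shows "pt (stage P f s 0) = pt s"
proof (cases "lm_alpha P f (CARD('n) - 1) s = 0")
  case True
  then show ?thesis by (simp add: line_min_def)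
next
  case False
  define a where "a = lam_s P * gstep s"
  have sb: "step_bounds P s (CARD('n) - 1)" using bounds by simp
  have "a > 0" using step_size_pos(1)[OF valid bdd sb] by (simp add: a_def)
  then have "f (pt (stage P f s 0)) \<le> f (pt s) - min 1 (a powr (1 / a))"
    using f_line_min_decrease[OF valid bdd sb False, of a] by (simp add: a_def)
  moreover have "0 < min 1 (a powr (1 / a))" using \<open>a > 0\<close> by simp
  ultimately show ?thesis using assms by linarith
qed

text \<open>Every accepted step costs a positive amount of \<open>f\<close>. The preliminary search
  is treated separately because \<open>stalled\<close> does not cover it.\<close>

lemma stalled_if_no_decrease:
  assumes "f (pt s) \<le> f (pt (rsp_cycle P f s))"
  shows "stalled P f s" "pt (stage P f s 0) = pt s"
proof -
  define a where "a = lam_s P * gstep s"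
  have "a > 0" using step_size_pos(1)[OF valid bdd bounds[of 0]] by (simp add: a_def)
  then have "0 < min 1 (a powr (1 / a))" by simp
  then show "stalled P f s"
    using f_cycle_decrease[of a, OF _ \<open>a > 0\<close> eq_refl[OF a_def]] assms by linarith
  show "pt (stage P f s 0) = pt s"
    using assms f_cycle_le_stage[of 0] by (intro pt_stage_0_eq) simp
qed

lemma pt_stage_stalled:
  assumes "stalled P f s" "j \<le> CARD('n)"
  shows "pt (stage P f s j) = pt (stage P f s 0)"
  using assms by (subst pt_stage_eq) (simp add: stalled_def)

text \<open>After the preliminary search a stalled cycle does not move, so the failed tests along
  all directions refer to one point, the start of the next cycle. The step size is read at stage
  \<open>j\<close>, before the failure shrinks it.\<close>

lemma stalled_no_improvement:
  assumes "stalled P f s" "j < CARD('n)" "\<sigma> = 1 \<or> \<sigma> = - 1"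
  shows "f (pt (rsp_cycle P f s)) - rho (steps (stage P f s j) j)
       < f (pt (rsp_cycle P f s) + steps (stage P f s j) j *\<^sub>R (\<sigma> *\<^sub>R dirs s j))"
proof -
  have "pt (rsp_cycle P f s) = pt (stage P f s j)"
    using pt_stage_stalled[of j] pt_stage_stalled[of "CARD('n)"] assms by (simp add: rsp_cycle_def)
  then show ?thesis
    using line_min_no_improvement[OF valid bdd step_bounds_stage[of j j], of \<sigma>] assms
    by (simp add: stalled_def cycle_alpha_def)
qed

lemma new_dir_eq: "new_dir P f s = pt (stage P f s CARD('n)) - pt (stage P f s 0)"
  by (subst pt_stage_eq) (simp add: new_dir_def)

lemma admissible_cycle: "admissible P (rsp_cycle P f s)"
  unfolding admissible_def
proof (intro allI impI)
  fix j assume "j < CARD('n)"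
  have g: "gstep s > 0" using bounds[of 0] by (simp add: step_bounds_def)
  have mu: "0 < mu_par P" "mu_par P < 1"
    using valid by (auto simp: valid_params_def) (smt (verit) divide_le_eq_1)
  have G: "0 < next_gstep P f s" "next_gstep P f s \<le> gstep s"
    using g mu by (auto simp: next_gstep_def mult_le_cancel_right1)
  have lam: "0 < lam_s P" "lam_s P \<le> lam_t P" using valid by (auto simp: valid_params_def)
  have E: "lam_s P * next_gstep P f s \<le> end_steps P f s i \<and> end_steps P f s i \<le> lam_t P * next_gstep P f s"
    if "i < CARD('n)" for i
  proof -
    have b: "lam_s P * gstep s \<le> steps (stage P f s CARD('n)) i" "steps (stage P f s CARD('n)) i \<le> lam_t P * gstep s"
      using step_bounds_stage[OF le_refl that] by (auto simp: step_bounds_def)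
    moreover have "lam_s P * next_gstep P f s \<le> lam_s P * gstep s"
      using lam G by (intro mult_left_mono) auto
    moreover have "lam_s P * next_gstep P f s \<le> lam_t P * next_gstep P f s"
      using lam G by (intro mult_right_mono) auto
    ultimately show ?thesis by (auto simp: end_steps_def next_gstep_def)
  qed
  \<comment> \<open>Shifting and taking a maximum create no new values, so each new step size
    inherits the bounds \<open>E\<close>.\<close>
  have "next_steps P f s j \<in> end_steps P f s ` {..<CARD('n)}"
  proof (cases "j < CARD('n) - 1")
    case True
    then show ?thesis by (auto simp: next_steps_def shift_last_def)
  next
    case False
    have "Max (end_steps P f s ` {1..<CARD('n)}) \<in> end_steps P f s ` {1..<CARD('n)}" if "CARD('n) \<noteq> 1"
      using that by (intro Max_in) (auto simp: neq_iff)
    then show ?thesis using False by (auto simp: next_steps_def shift_last_def)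
  qed
  then show "step_bounds P (rsp_cycle P f s) j"
    using E G by (auto simp: step_bounds_def rsp_cycle_def)
qed

end

subsection \<open>Convergence\<close>

locale rsp_run =
  fixes f :: "real ^ 'n::{finite,linorder} \<Rightarrow> real" and P :: rsp_params
    and s0 :: "(real ^ 'n::_) rsp_state"
  assumes A0: "assumption_A0 f" and A1: "assumption_A1 f" and A2: "assumption_A2 f"
    and valid: "valid_params P" and init: "valid_init P s0"
begin

abbreviation S where
  "S \<equiv> run_state P f s0"

lemma bdd: "bdd_below (range f)"
  using A0 by (simp add: assumption_A0_def)

lemma compact_sublevel: "compact {x. f x \<le> c}"
  using A2 by (simp add: assumption_A2_def)

lemma continuous_f: "continuous_on A f"
proof -
  obtain g where "\<And>x. GDERIV f x :> g x"
    using A0 by (auto simp: assumption_A0_def continuously_differentiable_def)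
  then have "isCont f x" for x
    unfolding gderiv_def by (rule has_derivative_continuous)
  then show ?thesis by (simp add: continuous_at_imp_continuous_on)
qed

lemma tendsto_f: "X \<longlonglongrightarrow> x \<Longrightarrow> (\<lambda>m. f (X m)) \<longlonglongrightarrow> f x"
  using continuous_f[of UNIV] by (auto intro: continuous_on_tendsto_compose)

lemma admissible_run: "admissible P (S k)"
proof (induction k)
  case 0
  then show ?case using init by (simp add: valid_init_def admissible_def step_bounds_def)
next
  case (Suc k)
  then show ?case by (simp add: admissible_cycle[OF valid bdd])
qed

lemma gstep_pos: "0 < gstep (S k)"
  using bounds[OF valid bdd admissible_run, of 0] by (simp add: step_bounds_def)

lemma f_run_Suc_le: "f (pt (S (Suc k))) \<le> f (pt (S k))"
  using f_cycle_le_stage[OF valid bdd admissible_run, of 0 k] f_stage_0_le[OF valid bdd admissible_run, of k]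
  by simp

lemma f_run_antimono: "k \<le> l \<Longrightarrow> f (pt (S l)) \<le> f (pt (S k))"
  by (rule lift_Suc_antimono_le[of "\<lambda>k. f (pt (S k))", OF f_run_Suc_le])

lemma iterate_le:
  assumes "j < CARD('n)" "i \<le> iterate_count P f s0 k j"
  shows "f (iterate P f s0 k j i) \<le> f (pt (S k))"
proof -
  have sb: "step_bounds P (stage P f (S k) j) j"
    using assms by (intro step_bounds_stage[OF valid bdd admissible_run]) auto
  have "f (iterate P f s0 k j i) \<le> f (pt (stage P f (S k) j))"
    using lm_state_le[OF valid bdd sb, of 0 i] assms(2)
    by (simp add: iterate_def iterate_count_def fst_lm_state_0[OF valid bdd sb])
  also have "\<dots> \<le> f (pt (S k))"
    using assms by (intro f_stage_le[OF valid bdd admissible_run]) auto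
  finally show ?thesis .
qed

section \<open>Vanishing step sizes\<close>

text \<open>Otherwise \<Phi> would be constant from some cycle on, and every later cycle would lower
  \<open>f\<close> by at least the same positive amount, against boundedness below.\<close>

lemma infinite_stalled: "infinite {k. stalled P f (S k)}"
proof
  assume "finite {k. stalled P f (S k)}"
  then obtain N where N: "\<And>k. stalled P f (S k) \<Longrightarrow> k < N"
    using finite_nat_bounded by blast
  define a where "a = lam_s P * gstep (S N)"
  define c where "c = min 1 (a powr (1 / a))"
  have "a > 0" using gstep_pos valid by (simp add: a_def valid_params_def)
  then have "c > 0" by (simp add: c_def)
  have G: "gstep (S (N + i)) = gstep (S N)" for i
  proof (induction i)
    case (Suc i)
    have "\<not> stalled P f (S (N + i))" using N[of "N + i"] by auto
    then show ?case using Suc by (auto simp: rsp_cycle_def next_gstep_def stalled_def)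
  qed simp
  have dec: "f (pt (S (N + i))) \<le> f (pt (S N)) - real i * c" for i
  proof (induction i)
    case (Suc i)
    have "\<not> stalled P f (S (N + i))" using N[of "N + i"] by auto
    then have "f (pt (S (N + Suc i))) \<le> f (pt (S (N + i))) - c"
      using f_cycle_decrease[OF valid bdd admissible_run, of "N + i" a] \<open>a > 0\<close> G[of i]
      by (simp add: a_def c_def)
    then show ?case using Suc by (simp add: algebra_simps)
  qed simp
  obtain b where b: "\<And>y. b \<le> f y" using bdd by (auto simp: bdd_below_def)
  obtain m :: nat where "real m * c > f (pt (S N)) - b"
    using \<open>c > 0\<close> reals_Archimedean3 by blast
  then show False using dec[of m] b[of "pt (S (N + m))"] by linarith
qed

lemma gstep_tendsto_0: "(\<lambda>k. gstep (S k)) \<longlonglongrightarrow> 0"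
proof -
  have mu: "0 < mu_par P" "mu_par P < 1"
    using valid by (auto simp: valid_params_def) (smt (verit) divide_le_eq_1)
  have "gstep (S (Suc k)) \<le> gstep (S k)" for k
    using mu gstep_pos[of k] by (simp add: rsp_cycle_def next_gstep_def mult_le_cancel_right1)
  then have dec: "decseq (\<lambda>k. gstep (S k))" by (rule decseq_SucI)
  then obtain L where L: "(\<lambda>k. gstep (S k)) \<longlonglongrightarrow> L" "\<And>k. L \<le> gstep (S k)"
    using decseq_convergent[of _ 0] gstep_pos less_imp_le by metis
  obtain r :: "nat \<Rightarrow> nat" where r: "strict_mono r" "\<And>m. stalled P f (S (r m))"
    using infinite_enumerate[OF infinite_stalled] by auto
  have *: "(\<lambda>m. mu_par P * gstep (S (r m))) \<longlonglongrightarrow> mu_par P * L"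
    using LIMSEQ_subseq_LIMSEQ[OF L(1) r(1)] by (intro tendsto_mult_left) (simp add: o_def)
  \<comment> \<open>Every stalled cycle multiplies \<Phi> by \<open>mu_par P\<close>, so the limit
    satisfies \<open>L \<le> mu_par P * L\<close>.\<close>
  have "L \<le> mu_par P * gstep (S (r m))" for m
    using L(2)[of "Suc (r m)"] r(2)[of m] by (simp add: rsp_cycle_def next_gstep_def stalled_def)
  then have "L \<le> mu_par P * L" by (intro LIMSEQ_le_const[OF *]) auto
  moreover have "0 \<le> L"
    using gstep_pos by (intro LIMSEQ_le_const[OF L(1)]) (auto intro: less_imp_le)
  ultimately have "L = 0" using mu by (smt (verit) mult_less_cancel_right2)
  then show ?thesis using L(1) by simp
qed

lemma stage_step_pos:
  "j < CARD('n) \<Longrightarrow> 0 < steps (stage P f (S k) j) j"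
  using step_bounds_stage[OF valid bdd admissible_run, of j j k]
  by (intro step_size_pos(2)[OF valid bdd]) auto

text \<open>The index may depend on \<open>m\<close> because a fixed direction changes its index
  under the cyclic shifts.\<close>

lemma stage_step_tendsto_0:
  assumes "filterlim r at_top sequentially" "\<And>m. J m < CARD('n)"
  shows "(\<lambda>m. steps (stage P f (S (r m)) (J m)) (J m)) \<longlonglongrightarrow> 0"
proof (rule tendsto_sandwich[OF _ _ tendsto_const])
  have "(\<lambda>m. lam_t P * gstep (S (r m))) \<longlonglongrightarrow> lam_t P * 0"
    by (intro tendsto_mult_left filterlim_compose[OF gstep_tendsto_0 assms(1)])
  then show "(\<lambda>m. lam_t P * gstep (S (r m))) \<longlonglongrightarrow> 0" by simp
  show "\<forall>\<^sub>F m in sequentially. 0 \<le> steps (stage P f (S (r m)) (J m)) (J m)"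
    using assms(2) stage_step_pos by (intro always_eventually) (auto intro: less_imp_le)
  show "\<forall>\<^sub>F m in sequentially. steps (stage P f (S (r m)) (J m)) (J m) \<le> lam_t P * gstep (S (r m))"
    using step_bounds_stage[OF valid bdd admissible_run, of "J _" "J _"] assms(2)
    by (intro always_eventually allI) (auto simp: step_bounds_def less_imp_le)
qed

section \<open>Bounded and uniformly independent directions\<close>

text \<open>A replaced set passes the determinant test, and a retained set is merely
  rotated.\<close>

lemma dirs_det_bounded_below:
  obtains c where "c > 0" "\<And>k. c \<le> \<bar>det_columns (dirs (S k))\<bar>"
proof
  let ?c = "min (delta_det P) \<bar>det_columns (dirs s0)\<bar>"
  have "det_columns (dirs s0) \<noteq> 0"
    using init by (intro det_columns_nonzero) (auto simp: valid_init_def)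
  then show "?c > 0" using valid by (auto simp: valid_params_def)
  show "?c \<le> \<bar>det_columns (dirs (S k))\<bar>" for k
  proof (induction k)
    case (Suc k)
    then show ?case
      using abs_det_columns_rotate[of "dirs (S k)"] by (auto simp: rsp_cycle_def next_dirs_def)
  qed simp
qed

lemma dirs_bounded:
  obtains B where "\<And>k j. j < CARD('n) \<Longrightarrow> norm (dirs (S k) j) \<le> B"
proof -
  obtain b where b: "\<And>x. f x \<le> f (pt s0) \<Longrightarrow> norm x \<le> b"
    using compact_imp_bounded[OF compact_sublevel, of "f (pt s0)"] by (auto simp: bounded_iff)
  \<comment> \<open>A new direction is the difference of two points of the initial sublevel set,
    hence the bound \<open>2 * b\<close>.\<close>
  define B where "B = max (2 * b) (Max ((\<lambda>j. norm (dirs s0 j)) ` {..<CARD('n)}))"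
  have new: "norm (new_dir P f (S k)) \<le> B" for k
  proof -
    have "f (pt (stage P f (S k) j)) \<le> f (pt s0)" if "j \<le> CARD('n)" for j
      using f_stage_le[OF valid bdd admissible_run, of j k] that f_run_antimono[of 0 k] by auto
    then have b_stage: "norm (pt (stage P f (S k) j)) \<le> b" if "j \<le> CARD('n)" for j
      using that by (intro b)
    have "norm (new_dir P f (S k)) \<le> norm (pt (stage P f (S k) CARD('n))) + norm (pt (stage P f (S k) 0))"
      unfolding new_dir_eq[OF valid bdd admissible_run] by (rule norm_triangle_ineq4)
    also have "\<dots> \<le> b + b" by (intro add_mono b_stage) simp_all
    finally have "norm (new_dir P f (S k)) \<le> b + b" .
    then show ?thesis by (simp add: B_def)
  qed
  have "norm (dirs (S k) j) \<le> B" if "j < CARD('n)" for k j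
    using that
  proof (induction k arbitrary: j)
    case 0
    then have "norm (dirs s0 j) \<le> Max ((\<lambda>j. norm (dirs s0 j)) ` {..<CARD('n)})"
      by (intro Max_ge) auto
    then show ?case by (simp add: B_def)
  next
    case (Suc k)
    then show ?case using new[of k] by (simp add: rsp_cycle_def next_dirs_def shift_last_def)
  qed
  then show ?thesis by (rule that)
qed

text \<open>Treating the directions as one matrix gives a common subsequence for all columns; the
  determinant bound survives in the limit.\<close>

lemma dirs_convergent_subsequence:
  fixes r :: "nat \<Rightarrow> nat"
  obtains q A where "strict_mono q" "(\<lambda>m. columns_matrix (dirs (S (r (q m))))) \<longlonglongrightarrow> A" "det A \<noteq> 0"
proof -
  obtain B where B: "\<And>k j. j < CARD('n) \<Longrightarrow> norm (dirs (S k) j) \<le> B"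
    using dirs_bounded by blast
  have "bounded (range (\<lambda>m. columns_matrix (dirs (S (r m)))))"
  proof (rule boundedI)
    fix M assume "M \<in> range (\<lambda>m. columns_matrix (dirs (S (r m))))"
    then obtain m where M: "M = columns_matrix (dirs (S (r m)))" by blast
    have "norm (M $ i) \<le> (\<Sum>j\<in>(UNIV :: 'n set). B)" for i
    proof (rule order_trans[OF norm_le_l1_cart] , rule sum_mono)
      fix j
      have "\<bar>M $ i $ j\<bar> \<le> norm (dirs (S (r m)) (ord_index j))"
        by (simp add: M columns_matrix_def component_le_norm_cart)
      also have "\<dots> \<le> B" by (intro B ord_index_less)
      finally show "\<bar>M $ i $ j\<bar> \<le> B" .
    qed
    moreover have "norm M \<le> (\<Sum>i\<in>UNIV. norm (M $ i))"
      unfolding norm_vec_def by (rule L2_set_le_sum) simp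
    ultimately show "norm M \<le> (\<Sum>i\<in>(UNIV :: 'n set). \<Sum>j\<in>(UNIV :: 'n set). B)"
      by (meson order_trans sum_mono)
  qed
  from bounded_imp_convergent_subsequence[OF this] obtain A q
    where A: "strict_mono q" "((\<lambda>m. columns_matrix (dirs (S (r m)))) \<circ> q) \<longlonglongrightarrow> A"
    by auto
  obtain c where c: "c > 0" "\<And>k. c \<le> \<bar>det_columns (dirs (S k))\<bar>"
    using dirs_det_bounded_below by blast
  have "(\<lambda>m. \<bar>det (columns_matrix (dirs (S (r (q m)))))\<bar>) \<longlonglongrightarrow> \<bar>det A\<bar>"
    using A(2) by (intro tendsto_rabs tendsto_det) (simp add: o_def)
  then have "c \<le> \<bar>det A\<bar>"
    using c(2) by (intro LIMSEQ_le_const) (auto simp: det_columns_eq)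
  then show ?thesis using that[of q A] A c(1) by (simp add: o_def)
qed

section \<open>Critical limit points of stalled cycles\<close>

lemma critical_limit_point:
  obtains x q where "strict_mono q" "\<And>m. stalled P f (S (q m))"
    "(\<lambda>m. pt (S (Suc (q m)))) \<longlonglongrightarrow> x" "critical_point f x"
proof -
  obtain g where g: "\<And>x. GDERIV f x :> g x" "continuous_on UNIV g"
    using A0 by (auto simp: assumption_A0_def continuously_differentiable_def)
  obtain r :: "nat \<Rightarrow> nat" where r: "strict_mono r" "\<And>m. stalled P f (S (r m))"
    using infinite_enumerate[OF infinite_stalled] by auto
  have "\<forall>m. pt (S (Suc (r m))) \<in> {x. f x \<le> f (pt s0)}"
    using f_run_antimono[of 0] by (metis (mono_tags) mem_Collect_eq run_state.simps(1) le0)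
  then obtain x p where p: "strict_mono p" "((\<lambda>m. pt (S (Suc (r m)))) \<circ> p) \<longlonglongrightarrow> x"
    using seq_compactE[OF compact_imp_seq_compact[OF compact_sublevel]] by metis
  obtain q A where q: "strict_mono q" "(\<lambda>m. columns_matrix (dirs (S ((r \<circ> p) (q m))))) \<longlonglongrightarrow> A" "det A \<noteq> 0"
    by (rule dirs_convergent_subsequence)
  \<comment> \<open>Stalled cycles along which both the end points and the directions
    converge.\<close>
  define t where "t = r \<circ> p \<circ> q"
  have t: "strict_mono t" "\<And>m. stalled P f (S (t m))"
    using r p q by (auto simp: t_def intro!: strict_mono_o)
  have X: "(\<lambda>m. pt (S (Suc (t m)))) \<longlonglongrightarrow> x"
    using LIMSEQ_subseq_LIMSEQ[OF p(2) q(1)] by (simp add: o_def t_def)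
  have "g x \<bullet> column j A = 0" for j
  proof -
    let ?j = "ord_index j"
    have "(\<lambda>m. column j (columns_matrix (dirs (S (t m))))) \<longlonglongrightarrow> column j A"
      unfolding column_def using q(2)
      by (intro tendsto_vec_lambda tendsto_vec_nth) (simp add: t_def o_def)
    then have V: "(\<lambda>m. dirs (S (t m)) ?j) \<longlonglongrightarrow> column j A"
      by (simp only: column_columns_matrix)
    \<comment> \<open>Failure of the tests with both signs gives two opposite inequalities, hence a
      zero inner product.\<close>
    have "0 \<le> g x \<bullet> (\<sigma> *\<^sub>R column j A)" if "\<sigma> = 1 \<or> \<sigma> = - 1" for \<sigma>
    proof (rule gradient_inner_limit_nonneg[OF g X])
      show "(\<lambda>m. \<sigma> *\<^sub>R dirs (S (t m)) ?j) \<longlonglongrightarrow> \<sigma> *\<^sub>R column j A" by (intro tendsto_intros V)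
      show "(\<lambda>m. steps (stage P f (S (t m)) ?j) ?j) \<longlonglongrightarrow> 0"
        by (intro stage_step_tendsto_0 filterlim_subseq t ord_index_less)
      show "0 < steps (stage P f (S (t m)) ?j) ?j" for m by (intro stage_step_pos ord_index_less)
      show "f (pt (S (Suc (t m)))) - rho (steps (stage P f (S (t m)) ?j) ?j)
          \<le> f (pt (S (Suc (t m))) + steps (stage P f (S (t m)) ?j) ?j *\<^sub>R (\<sigma> *\<^sub>R dirs (S (t m)) ?j))" for m
        using stalled_no_improvement[OF valid bdd admissible_run t(2)[of m] ord_index_less[of j] that]
        by simp
    qed
    from this[of 1] this[of "- 1"] show ?thesis by simp
  qed
  then have "g x = 0" using q(3) by (rule eq_0_if_inner_columns[rotated])
  then have "critical_point f x" using g(1)[of x] by (simp add: critical_point_def)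
  with t X show ?thesis by (rule that)
qed

section \<open>Exclusion of local maxima\<close>

text \<open>In a stalled cycle the new direction is 0, so the determinant test fails and the old
  directions are only rotated: a direction changes its index but never disappears.\<close>

lemma stuck_direction:
  assumes "\<And>k. k \<ge> K \<Longrightarrow> stalled P f (S k)" "k \<ge> K"
  shows "\<exists>j<CARD('n). dirs (S k) j = dirs (S K) 0"
  using assms(2)
proof (induction rule: dec_induct)
  case base
  then show ?case by (intro exI[of _ 0]) simp
next
  case (step k)
  have "new_dir P f (S k) = 0"
    using assms(1)[OF step.hyps(1)] by (simp add: new_dir_def stalled_def)
  then have "det_columns (shift_last CARD('n) (dirs (S k)) (new_dir P f (S k))) = 0"
    by (intro det_columns_eq_0[of "CARD('n) - 1"]) (auto simp: shift_last_def)
  then have next_dirs: "dirs (S (Suc k)) = shift_last CARD('n) (dirs (S k)) (dirs (S k) 0)"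
    using valid by (simp add: rsp_cycle_def next_dirs_def valid_params_def)
  obtain j where j: "j < CARD('n)" "dirs (S k) j = dirs (S K) 0" using step by blast
  show ?case
  proof (cases j)
    case 0
    then show ?thesis using j next_dirs by (intro exI[of _ "CARD('n) - 1"]) (simp add: shift_last_def)
  next
    case (Suc i)
    then show ?thesis using j next_dirs by (intro exI[of _ i]) (auto simp: shift_last_def)
  qed
qed

lemma not_stuck_at_local_maximum:
  assumes "local_maximum f x" "\<And>k. k \<ge> K \<Longrightarrow> stalled P f (S k)" "\<And>k. k \<ge> K \<Longrightarrow> pt (S k) = x"
  shows False
proof -
  define d where "d = dirs (S K) 0"
  have "d \<noteq> 0"
  proof
    assume "d = 0"
    then have "det_columns (dirs (S K)) = 0" by (intro det_columns_eq_0[of 0]) (auto simp: d_def)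
    then show False using dirs_det_bounded_below by (metis abs_zero not_less)
  qed
  have "x isolated_in {z. local_maximum f z}" "real_analytic_at f x"
    using A1 assms(1) by (auto simp: assumption_A1_def)
  then have ev: "\<forall>\<^sub>F t in at_right 0. f (x + t *\<^sub>R d) \<le> f x - rho t"
    using assms(1) \<open>d \<noteq> 0\<close> by (intro isolated_analytic_maximum_decrease)
  have "\<forall>m. \<exists>j<CARD('n). dirs (S (K + m)) j = d"
    using stuck_direction[OF assms(2)] by (auto simp: d_def)
  then obtain J where J: "\<And>m. J m < CARD('n)" "\<And>m. dirs (S (K + m)) (J m) = d" by metis
  define T where "T = (\<lambda>m. steps (stage P f (S (K + m)) (J m)) (J m))"
  have "T \<longlonglongrightarrow> 0" unfolding T_def
    by (intro stage_step_tendsto_0 J filterlim_subseq) (simp add: strict_mono_def)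
  moreover have "T m \<in> {0<..} \<and> T m \<noteq> 0" for m
    using stage_step_pos[OF J(1)[of m], of "K + m"] by (simp add: T_def)
  ultimately have "filterlim T (at_right 0) sequentially"
    unfolding filterlim_at by (blast intro: always_eventually)
  then have "\<forall>\<^sub>F m in sequentially. f (x + T m *\<^sub>R d) \<le> f x - rho (T m)"
    using ev by (rule eventually_compose_filterlim[rotated])
  then obtain m where m: "f (x + T m *\<^sub>R d) \<le> f x - rho (T m)"
    by (meson eventually_happens sequentially_bot)
  \<comment> \<open>The failed test is stated at the start of cycle \<open>Suc (K + m)\<close>,
    which is again \<open>x\<close>.\<close>
  have "f x - rho (T m) < f (x + T m *\<^sub>R d)"
    using stalled_no_improvement[OF valid bdd admissible_run assms(2)[of "K + m"] J(1)[of m], of 1]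
      assms(3)[of "Suc (K + m)"] J(2)[of m] by (simp add: T_def)
  with m show False by simp
qed

lemma limit_in_global_minima:
  obtains x where "x \<in> global_minima f" "(\<lambda>k. f (pt (S k))) \<longlonglongrightarrow> f x"
proof -
  obtain x q where q: "strict_mono q" "(\<lambda>m. pt (S (Suc (q m)))) \<longlonglongrightarrow> x" "critical_point f x"
    by (rule critical_limit_point)
  obtain b where "\<And>y. b \<le> f y" using bdd by (auto simp: bdd_below_def)
  then obtain L where L: "(\<lambda>k. f (pt (S k))) \<longlonglongrightarrow> L" "\<And>k. L \<le> f (pt (S k))"
    using decseq_convergent[of "\<lambda>k. f (pt (S k))" b] f_run_Suc_le by (metis decseq_SucI)
  have sub: "strict_mono (\<lambda>m. Suc (q m))" using q(1) by (simp add: strict_mono_def)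
  have "L = f x"
    using LIMSEQ_unique[OF _ tendsto_f[OF q(2)]] LIMSEQ_subseq_LIMSEQ[OF L(1) sub] by (simp add: o_def)
  have "\<not> local_maximum f x"
  proof
    assume max: "local_maximum f x"
    then obtain e where e: "e > 0" "\<forall>y\<in>ball x e. f y \<le> f x"
      unfolding local_maximum_def by blast
    have "x isolated_in {z. local_maximum f z}"
      using A1 max by (auto simp: assumption_A1_def)
    then obtain e' where e': "e' > 0" "\<And>y. local_maximum f y \<Longrightarrow> dist x y < e' \<Longrightarrow> y = x"
      using isolated_inE_dist by (metis mem_Collect_eq)
    have "\<forall>\<^sub>F m in sequentially. dist (pt (S (Suc (q m)))) x < min e e'"
      using q(2) e(1) e'(1) by (intro tendstoD) auto
    then obtain m where "dist (pt (S (Suc (q m)))) x < min e e'"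
      by (meson eventually_happens sequentially_bot)
    then obtain K where K: "dist x (pt (S K)) < min e e'" by (metis dist_commute)
    \<comment> \<open>Maximality bounds the value from above, the limit of the decreasing values
      from below.\<close>
    then have "f (pt (S K)) = f x" using e(2) L(2)[of K] \<open>L = f x\<close> by (simp add: order_antisym)
    then have "local_maximum f (pt (S K))"
      using K by (intro local_maximum_of_equal_value[OF e(2)]) auto
    then have hit: "pt (S K) = x" using K by (intro e'(2)) auto
    \<comment> \<open>From \<open>K\<close> on \<open>f\<close> has reached its limit value, so no
      cycle can lower it any more.\<close>
    have stall: "stalled P f (S k)" "pt (stage P f (S k) 0) = pt (S k)" if "k \<ge> K" for k
    proof -
      have "f (pt (S k)) \<le> f (pt (rsp_cycle P f (S k)))"
        using f_run_antimono[OF that] hit L(2)[of "Suc k"] \<open>L = f x\<close> by simp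
      from stalled_if_no_decrease[OF valid bdd admissible_run this]
      show "stalled P f (S k)" "pt (stage P f (S k) 0) = pt (S k)" by auto
    qed
    have stuck: "pt (S k) = x" if "k \<ge> K" for k
      using that
    proof (induction rule: dec_induct)
      case (step k)
      have "pt (S (Suc k)) = pt (S k)"
        using pt_stage_stalled[OF valid bdd admissible_run stall(1)[OF step.hyps(1)], of "CARD('n)"] stall(2)[OF step.hyps(1)]
        by (simp add: rsp_cycle_def)
      then show ?case using step by simp
    qed (rule hit)
    show False by (rule not_stuck_at_local_maximum[OF max stall(1) stuck])
  qed
  then have "x \<in> global_minima f"
    using A1 q(3) by (auto simp: assumption_A1_def)
  with L(1) \<open>L = f x\<close> show ?thesis by (intro that) auto
qed

section \<open>Convergence of all iterates\<close>

text \<open>All iterates of cycle \<open>k\<close> lie in the sublevel set of its starting value,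
  which makes the estimate uniform in \<open>j\<close> and \<open>i\<close>.\<close>

lemma iterates_converge:
  "(\<lambda>k. MAX j\<in>{..<CARD('n)}. MAX i\<in>{..iterate_count P f s0 k j}.
      infdist (iterate P f s0 k j i) (global_minima f)) \<longlonglongrightarrow> 0"
proof (rule LIMSEQ_I)
  fix e :: real assume "e > 0"
  \<comment> \<open>The point \<open>x\<close> also shows that global minima exist, so
    \<open>infdist\<close> is a genuine distance and not the default value 0 for the empty
    set.\<close>
  obtain x where x: "x \<in> global_minima f" "(\<lambda>k. f (pt (S k))) \<longlonglongrightarrow> f x"
    by (rule limit_in_global_minima)
  obtain \<delta> where \<delta>: "\<delta> > 0" "\<And>y. f y < f x + \<delta> \<Longrightarrow> infdist y (global_minima f) < e"
    by (rule infdist_global_minima_sublevel[OF continuous_f compact_sublevel \<open>e > 0\<close> x(1)]) (rule that)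
  have "\<forall>\<^sub>F k in sequentially. f (pt (S k)) < f x + \<delta>"
    using x(2) \<delta>(1) by (intro order_tendstoD) auto
  then obtain N where N: "\<And>k. k \<ge> N \<Longrightarrow> f (pt (S k)) < f x + \<delta>"
    by (auto simp: eventually_sequentially)
  show "\<exists>N. \<forall>k\<ge>N. norm ((MAX j\<in>{..<CARD('n)}. MAX i\<in>{..iterate_count P f s0 k j}.
      infdist (iterate P f s0 k j i) (global_minima f)) - 0) < e"
  proof (intro exI[of _ N] allI impI)
    fix k assume "k \<ge> N"
    have inner: "infdist (iterate P f s0 k j i) (global_minima f) < e"
      if "j < CARD('n)" "i \<le> iterate_count P f s0 k j" for j i
      using \<delta>(2) iterate_le[OF that] N[OF \<open>k \<ge> N\<close>] by fastforce
    define D where "D = (\<lambda>j. MAX i\<in>{..iterate_count P f s0 k j}. infdist (iterate P f s0 k j i) (global_minima f))"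
    have "D j < e" if "j < CARD('n)" for j
      unfolding D_def using inner[OF that] by (subst Max_less_iff) auto
    moreover have "0 \<le> D 0"
      unfolding D_def by (subst Max_ge_iff) (auto intro!: exI[of _ 0] infdist_nonneg)
    moreover have "D 0 \<le> (MAX j\<in>{..<CARD('n)}. D j)"
      by (intro Max_ge) auto
    moreover have "(MAX j\<in>{..<CARD('n)}. D j) \<in> D ` {..<CARD('n)}"
      by (intro Max_in) (simp_all add: lessThan_empty_iff)
    ultimately have "(MAX j\<in>{..<CARD('n)}. D j) < e" "0 \<le> (MAX j\<in>{..<CARD('n)}. D j)"
      by (force, linarith)
    then show "norm ((MAX j\<in>{..<CARD('n)}. MAX i\<in>{..iterate_count P f s0 k j}.
      infdist (iterate P f s0 k j i) (global_minima f)) - 0) < e"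
      by (simp add: D_def)
  qed
qed

end

theorem theorem6:
  fixes f :: "real ^ 'n::{finite,linorder} \<Rightarrow> real"
    and P :: rsp_params
    and s0 :: "(real ^ 'n::_) rsp_state"
  assumes "assumption_A0 f" and "assumption_A1 f" and "assumption_A2 f"
    and "valid_params P"
    and "valid_init P s0"
  shows "(\<lambda>k. MAX j\<in>{..<CARD('n)}. MAX i\<in>{..iterate_count P f s0 k j}.
            infdist (iterate P f s0 k j i) (global_minima f)) \<longlonglongrightarrow> 0"
  by (rule rsp_run.iterates_converge, unfold_locales) (fact assms)+

end
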